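(* Let $\mathbb V$ be the full amplitude space and let $t_*\in\mathbb V$ be a zero of the Full CC mapping $\mathcal A:\mathbb V\to\mathbb V^*$. Then $e^{T_*}\Phi_0\in\mathfrak H^2$ is an (intermediately normalized, i.e. $\langle e^{T_*}\Phi_0,\Phi_0\rangle=1$) eigenfunction of $\mathcal H_K$ corresponding to some non-degenerate (i.e. simple) eigenvalue $\mathcal E_\nu(\mathcal H_K)$ if and only if $t_*$ is non-degenerate (i.e. $\mathcal A'(t_* )$ is invertible), and in this case $i(\mathcal A,t_* )=(-1)^\nu$.
   Context: Setting. Fix $1\le N\le K<\infty$. Let $\mathfrak L^2=\bigwedge^N L^2(\mathbb R^3)$ with inner product $\langle\cdot,\cdot\rangle$, $\mathfrak H^k=\mathfrak L^2\cap H^k(\mathbb R^{3N})$, $k=1,2$. Let $\phi_1,\dots,\phi_K\in H^2(\mathbb R^3)$ be $L^2$-orthonormal; $\phi_1,\dots,\phi_N$ are called occupied, the others virtual. For a multiindex $\alpha=(\alpha_1<\dots<\alpha_N)$ in $\{1,\dots,K\}$, $\Phi_\alpha=\phi_{\alpha_1}\wedge\dots\wedge\phi_{\alpha_N}$ is the ($\mathfrak L^2$-normalized) Slater determinant; these form an orthonormal basis of $\mathfrak H^1_K:=\mathrm{Span}\{\Phi_\alpha\}$. The index $0$ means $(1,\dots,N)$, and $\Phi_0=\phi_1\wedge\dots\wedge\phi_N$ is the reference. The Hamiltonian is $\mathcal H=\sum_i[-\tfrac12\Delta_{x_i}+V(x_i)]+\sum_{i<j}w(x_i-x_j)$ with real-valued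 $V,w\in L^{3/2}(\mathbb R^3)+L^\infty_\varepsilon(\mathbb R^3)$ (the $L^\infty$ part can be chosen arbitrarily small), $w$ even; $\mathcal H_K:\mathfrak H^1_K\to(\mathfrak H^1_K)^*$ is defined by $\langle\mathcal H_K\Phi,\Psi\rangle=\langle\mathcal H\Phi,\Psi\rangle$ (in the form sense) and is regarded as a (symmetric) operator on $\mathfrak H_K^1$ via $\langle\cdot,\cdot\rangle$. Its eigenvalues, in increasing order and with multiplicity, are $\mathcal E_0(\mathcal H_K)\le\mathcal E_1(\mathcal H_K)\le\cdots$. Everything is over $\mathbb R$ (the matrix elements $\langle\mathcal H_K\Phi_\alpha,\Phi_\beta\rangle$ are real). Excitation and cluster operators. For $\alpha\ne0$ with virtual indices $A_1<\dots<A_r$ and with $I_1<\dots<I_r$ the occupied indices missing from $\alpha$, $X_\alpha=a_{A_1}^\dagger a_{I_1}\cdots a_{A_r}^\dagger a_{I_r}$, where $a_p^\dagger,a_p$ are the fermionic creation/annihilation operators of $\phi_p$; the sign of $\Phi_\alpha$ is chosen so that $\Phi_\alpha=X_\alpha\Phi_0$. Full amplitude space: $\mathbb V=\{t=(t_\alpha)_{\alpha\ne0}:t_\alpha\in\mathbb R\}$, over all nonzero multiindices; the cluster operator of $t$ is $T=\sum_{\alpha\neq0}t_\alpha X_\alpha$ (capital letters denote the cluster operators of lower-case amplitudes); $\langle t,s\rangle_{\mathbb V}=\langle T\Phi_0,S\Phi_0\rangle_{\mathfrak H^1}$. Full CC mapping: $\mathcal A:\mathbb V\to\mathbb V^*$,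 $\langle\mathcal A(t),s\rangle=\langle e^{-T}\mathcal H_Ke^T\Phi_0,S\Phi_0\rangle$ for all $s\in\mathbb V$. Index. For an isolated zero $u$, $i(\mathcal A,u)=\deg(\mathcal A,B(u,r),0)$ (Brouwer degree, $r>0$ small), where $\mathbb V,\mathbb V^*$ are identified with $\mathbb R^n$ compatibly oriented (the dual basis of a positive basis is positive). *)

theory Defs
  imports "HOL-Analysis.Analysis" "HOL-Homology.Homology"
begin

section \<open>Function spaces\<close>

text \<open>Elements of \<open>L\<^sup>p\<close> and Sobolev spaces are represented by Borel functions.\<close>

definition L2 :: "('a::euclidean_space \<Rightarrow> real) set" where
  "L2 = {u. u \<in> borel_measurable lborel \<and> integrable lborel (\<lambda>x. (u x)\<^sup>2)}"

definition L2_inner :: "('a::euclidean_space \<Rightarrow> real) \<Rightarrow> ('a \<Rightarrow> real) \<Rightarrow> real" where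
  "L2_inner u v = (\<integral>x. u x * v x \<partial>lborel)"

primrec C_k :: "nat \<Rightarrow> ('a::euclidean_space \<Rightarrow> real) \<Rightarrow> bool" where
  "C_k 0 f \<longleftrightarrow> continuous_on UNIV f"
| "C_k (Suc k) f \<longleftrightarrow> f differentiable_on UNIV \<and>
     (\<forall>b\<in>Basis. C_k k (\<lambda>x. frechet_derivative f (at x) b))"

definition test_function :: "('a::euclidean_space \<Rightarrow> real) \<Rightarrow> bool" where
  "test_function \<eta> \<longleftrightarrow> (\<forall>k. C_k k \<eta>) \<and> (\<exists>C. compact C \<and> (\<forall>x. x \<notin> C \<longrightarrow> \<eta> x = 0))"

definition has_weak_partial ::
  "('a::euclidean_space \<Rightarrow> real) \<Rightarrow> 'a \<Rightarrow> ('a \<Rightarrow> real) \<Rightarrow> bool" where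
  "has_weak_partial u b g \<longleftrightarrow>
     (\<forall>\<eta>. test_function \<eta> \<longrightarrow>
        (\<integral>x. u x * frechet_derivative \<eta> (at x) b \<partial>lborel) = - (\<integral>x. g x * \<eta> x \<partial>lborel))"

text \<open>\<open>sobolev k\<close> is \<open>H\<^sup>k = W\<^sup>k\<^sup>,\<^sup>2\<close>.\<close>

primrec sobolev :: "nat \<Rightarrow> ('a::euclidean_space \<Rightarrow> real) set" where
  "sobolev 0 = L2"
| "sobolev (Suc k) = {u \<in> L2. \<forall>b\<in>Basis. \<exists>g\<in>sobolev k. has_weak_partial u b g}"

text \<open>A representative of the weak partial derivative, which is unique almost everywhere.\<close>

definition weak_partial :: "('a::euclidean_space \<Rightarrow> real) \<Rightarrow> 'a \<Rightarrow> 'a \<Rightarrow> real" where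
  "weak_partial u b = (SOME g. g \<in> L2 \<and> has_weak_partial u b g)"

text \<open>The class \<open>L\<^sup>3\<^sup>/\<^sup>2 + L\<^sup>\<infinity>\<^sub>\<epsilon>\<close>: the bounded part can be chosen arbitrarily small.\<close>

definition L32_plus_Linf_eps :: "(real^3 \<Rightarrow> real) set" where
  "L32_plus_Linf_eps = {V. \<forall>\<epsilon>>0. \<exists>V1 V2.
     V1 \<in> borel_measurable lborel \<and> integrable lborel (\<lambda>x. \<bar>V1 x\<bar> powr (3/2)) \<and>
     V2 \<in> borel_measurable lborel \<and> (AE x in lborel. \<bar>V2 x\<bar> \<le> \<epsilon>) \<and>
     V = (\<lambda>x. V1 x + V2 x)}"

section \<open>Many-particle functions\<close>

text \<open>
  The particles are the elements of a finite linearly ordered type \<open>'n\<close>, so \<open>N = CARD('n)\<close>.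
  The orbitals are indexed by a finite linearly ordered type \<open>'k\<close>, so \<open>K = CARD('k)\<close>.
\<close>

type_synonym 'n config = "(real^3)^'n"

definition antisymmetric_L2 :: "('n::finite config \<Rightarrow> real) set" where
  "antisymmetric_L2 = {\<Psi> \<in> L2. \<forall>\<sigma>. \<sigma> permutes UNIV \<longrightarrow>
     (AE x in lborel. \<Psi> (\<chi> i. x $ \<sigma> i) = of_int (sign \<sigma>) * \<Psi> x)}"

definition antisymmetric_sobolev :: "nat \<Rightarrow> ('n::finite config \<Rightarrow> real) set" where
  "antisymmetric_sobolev k = antisymmetric_L2 \<inter> sobolev k"

text \<open>
  The normalized wedge product of the orbitals in \<open>\<alpha>\<close>, taken in increasing order.
  It is used only when \<open>card \<alpha> = CARD('n)\<close>.
\<close>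

definition slater ::
  "('k::{finite,linorder} \<Rightarrow> real^3 \<Rightarrow> real) \<Rightarrow> 'k set \<Rightarrow> 'n::{finite,linorder} config \<Rightarrow> real" where
  "slater \<phi> \<alpha> x =
     det (\<chi> i j. \<phi> (sorted_list_of_set \<alpha> ! card {l. l < j}) (x $ i)) / sqrt (fact CARD('n))"

definition energy_form ::
  "(real^3 \<Rightarrow> real) \<Rightarrow> (real^3 \<Rightarrow> real) \<Rightarrow>
   ('n::{finite,linorder} config \<Rightarrow> real) \<Rightarrow> ('n config \<Rightarrow> real) \<Rightarrow> real" where
  "energy_form V w \<Phi> \<Psi> =
     1/2 * (\<Sum>b\<in>Basis. \<integral>x. weak_partial \<Phi> b x * weak_partial \<Psi> b x \<partial>lborel)
     + (\<Sum>i\<in>UNIV. \<integral>x. V (x $ i) * \<Phi> x * \<Psi> x \<partial>lborel)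
     + (\<Sum>(i,j)\<in>{(i,j). i < j}. \<integral>x. w (x $ i - x $ j) * \<Phi> x * \<Psi> x \<partial>lborel)"

section \<open>Second quantization\<close>

text \<open>
  The Fock space over the orbitals is \<open>real^('k set)\<close>: the unit vector \<open>axis S 1\<close> is the
  increasing wedge product of the orbitals in \<open>S\<close>.  With respect to this basis the creation
  operator is \<open>\<phi>\<^sub>p \<and> _\<close> and the annihilation operator is its adjoint.
\<close>

type_synonym 'k fock = "real^('k set)"

definition creation :: "'k::{finite,linorder} \<Rightarrow> 'k fock \<Rightarrow> 'k fock" where
  "creation p c = (\<chi> S. if p \<in> S then (-1) ^ card {q\<in>S. q < p} * c $ (S - {p}) else 0)"

definition annihilation :: "'k::{finite,linorder} \<Rightarrow> 'k fock \<Rightarrow> 'k fock" where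
  "annihilation p c = (\<chi> S. if p \<notin> S then (-1) ^ card {q\<in>S. q < p} * c $ (insert p S) else 0)"

text \<open>The occupied orbitals are the first \<open>N\<close> ones; this set is also the multiindex \<open>0\<close>.\<close>

definition occupied :: "nat \<Rightarrow> 'k::{finite,linorder} set" where
  "occupied N = {p. card {q. q < p} < N}"

definition excited :: "nat \<Rightarrow> 'k::{finite,linorder} set set" where
  "excited N = {\<alpha>. card \<alpha> = N \<and> \<alpha> \<noteq> occupied N}"

definition reference :: "nat \<Rightarrow> 'k::{finite,linorder} fock" where
  "reference N = axis (occupied N) 1"

definition excitation :: "nat \<Rightarrow> 'k::{finite,linorder} set \<Rightarrow> 'k fock \<Rightarrow> 'k fock" where
  "excitation N \<alpha> =
     foldr (\<lambda>(A, I) F. creation A \<circ> annihilation I \<circ> F)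
       (zip (sorted_list_of_set (\<alpha> - occupied N)) (sorted_list_of_set (occupied N - \<alpha>))) id"

text \<open>
  The coordinate space of \<open>\<HH>\<^sup>1\<^sub>K\<close> with respect to the Slater basis, and the function
  belonging to a coordinate vector.
\<close>

definition sector :: "nat \<Rightarrow> 'k::{finite,linorder} fock set" where
  "sector N = {c. \<forall>S. card S \<noteq> N \<longrightarrow> c $ S = 0}"

definition wavefunction ::
  "('k::{finite,linorder} \<Rightarrow> real^3 \<Rightarrow> real) \<Rightarrow> 'k fock \<Rightarrow> 'n::{finite,linorder} config \<Rightarrow> real" where
  "wavefunction \<phi> c x = (\<Sum>\<alpha> | card \<alpha> = CARD('n). c $ \<alpha> * slater \<phi> \<alpha> x)"

text \<open>
  \<open>\<H>\<^sub>K\<close> as an operator on \<open>\<HH>\<^sup>1\<^sub>K\<close>: the linear operator whose matrix elements in the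
  orthonormal Slater basis are the values of the (bilinear) energy form.
\<close>

definition HK ::
  "'n::{finite,linorder} itself \<Rightarrow> ('k::{finite,linorder} \<Rightarrow> real^3 \<Rightarrow> real) \<Rightarrow>
   (real^3 \<Rightarrow> real) \<Rightarrow> (real^3 \<Rightarrow> real) \<Rightarrow> 'k fock \<Rightarrow> 'k fock" where
  "HK _ \<phi> V w c = (\<chi> \<beta>. if card \<beta> = CARD('n) then
     (\<Sum>\<alpha> | card \<alpha> = CARD('n).
        c $ \<alpha> * energy_form V w (slater \<phi> \<alpha> :: 'n config \<Rightarrow> real) (slater \<phi> \<beta>)) else 0)"

definition eigenspace ::
  "'n::{finite,linorder} itself \<Rightarrow> ('k::{finite,linorder} \<Rightarrow> real^3 \<Rightarrow> real) \<Rightarrow>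
   (real^3 \<Rightarrow> real) \<Rightarrow> (real^3 \<Rightarrow> real) \<Rightarrow> real \<Rightarrow> 'k fock set" where
  "eigenspace n \<phi> V w E = {c \<in> sector CARD('n). HK n \<phi> V w c = E *\<^sub>R c}"

text \<open>The eigenvalues of \<open>\<H>\<^sub>K\<close> in increasing order, repeated according to multiplicity.\<close>

definition eigenvalue_list ::
  "'n::{finite,linorder} itself \<Rightarrow> ('k::{finite,linorder} \<Rightarrow> real^3 \<Rightarrow> real) \<Rightarrow>
   (real^3 \<Rightarrow> real) \<Rightarrow> (real^3 \<Rightarrow> real) \<Rightarrow> real list" where
  "eigenvalue_list n \<phi> V w =
     (THE Es. sorted Es \<and> (\<forall>E. count_list Es E = dim (eigenspace n \<phi> V w E)))"

definition eigenfunction ::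
  "('k::{finite,linorder} \<Rightarrow> real^3 \<Rightarrow> real) \<Rightarrow> (real^3 \<Rightarrow> real) \<Rightarrow> (real^3 \<Rightarrow> real) \<Rightarrow>
   ('n::{finite,linorder} config \<Rightarrow> real) \<Rightarrow> real \<Rightarrow> bool" where
  "eigenfunction \<phi> V w \<Psi> E \<longleftrightarrow>
     (\<exists>c \<in> eigenspace TYPE('n) \<phi> V w E. c \<noteq> 0 \<and> \<Psi> = wavefunction \<phi> c)"

definition simple_eigenvalue ::
  "'n::{finite,linorder} itself \<Rightarrow> ('k::{finite,linorder} \<Rightarrow> real^3 \<Rightarrow> real) \<Rightarrow>
   (real^3 \<Rightarrow> real) \<Rightarrow> (real^3 \<Rightarrow> real) \<Rightarrow> real \<Rightarrow> bool" where
  "simple_eigenvalue n \<phi> V w E \<longleftrightarrow> dim (eigenspace n \<phi> V w E) = 1"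

section \<open>The full coupled-cluster mapping\<close>

text \<open>Amplitudes \<open>(t\<^sub>\<alpha>)\<close>, \<open>\<alpha> \<noteq> 0\<close>, are vectors supported on the nonzero multiindices.\<close>

definition amplitudes :: "nat \<Rightarrow> (real^('k::{finite,linorder} set)) set" where
  "amplitudes N = {t. \<forall>S. S \<notin> excited N \<longrightarrow> t $ S = 0}"

definition cluster :: "nat \<Rightarrow> real^('k::{finite,linorder} set) \<Rightarrow> 'k fock \<Rightarrow> 'k fock" where
  "cluster N t c = (\<Sum>\<alpha>\<in>excited N. t $ \<alpha> *\<^sub>R excitation N \<alpha> c)"

definition exp_op :: "('a::real_normed_vector \<Rightarrow> 'a) \<Rightarrow> 'a \<Rightarrow> 'a" where
  "exp_op F c = suminf (\<lambda>k. (F ^^ k) c /\<^sub>R fact k)"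

definition cc_map ::
  "'n::{finite,linorder} itself \<Rightarrow> ('k::{finite,linorder} \<Rightarrow> real^3 \<Rightarrow> real) \<Rightarrow>
   (real^3 \<Rightarrow> real) \<Rightarrow> (real^3 \<Rightarrow> real) \<Rightarrow>
   real^('k set) \<Rightarrow> real^('k set) \<Rightarrow> real" where
  "cc_map n \<phi> V w t s =
     (let N = CARD('n); T = cluster N t; S = cluster N s in
      L2_inner
        (wavefunction \<phi> (exp_op (\<lambda>c. - T c) (HK n \<phi> V w (exp_op T (reference N)))) :: 'n config \<Rightarrow> real)
        (wavefunction \<phi> (S (reference N))))"

text \<open>
  The same mapping with the functional \<open>cc_map n \<phi> V w t\<close> replaced by its coordinates in the
  basis dual to the unit vectors of the amplitude space.
\<close>

definition cc_vec ::
  "'n::{finite,linorder} itself \<Rightarrow> ('k::{finite,linorder} \<Rightarrow> real^3 \<Rightarrow> real) \<Rightarrow>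
   (real^3 \<Rightarrow> real) \<Rightarrow> (real^3 \<Rightarrow> real) \<Rightarrow> real^('k set) \<Rightarrow> real^('k set)" where
  "cc_vec n \<phi> V w t =
     (\<chi> \<alpha>. if \<alpha> \<in> excited CARD('n) then cc_map n \<phi> V w t (axis \<alpha> 1) else 0)"

definition cc_zero ::
  "'n::{finite,linorder} itself \<Rightarrow> ('k::{finite,linorder} \<Rightarrow> real^3 \<Rightarrow> real) \<Rightarrow>
   (real^3 \<Rightarrow> real) \<Rightarrow> (real^3 \<Rightarrow> real) \<Rightarrow> real^('k set) \<Rightarrow> bool" where
  "cc_zero n \<phi> V w t \<longleftrightarrow> t \<in> amplitudes CARD('n) \<and>
     (\<forall>s \<in> amplitudes CARD('n). cc_map n \<phi> V w t s = 0)"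

definition isolated_cc_zero ::
  "'n::{finite,linorder} itself \<Rightarrow> ('k::{finite,linorder} \<Rightarrow> real^3 \<Rightarrow> real) \<Rightarrow>
   (real^3 \<Rightarrow> real) \<Rightarrow> (real^3 \<Rightarrow> real) \<Rightarrow> real^('k set) \<Rightarrow> bool" where
  "isolated_cc_zero n \<phi> V w t \<longleftrightarrow> cc_zero n \<phi> V w t \<and>
     (\<exists>r>0. \<forall>s. cc_zero n \<phi> V w s \<and> dist s t < r \<longrightarrow> s = t)"

definition nondegenerate ::
  "'n::{finite,linorder} itself \<Rightarrow> ('k::{finite,linorder} \<Rightarrow> real^3 \<Rightarrow> real) \<Rightarrow>
   (real^3 \<Rightarrow> real) \<Rightarrow> (real^3 \<Rightarrow> real) \<Rightarrow> real^('k set) \<Rightarrow> bool" where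
  "nondegenerate n \<phi> V w t \<longleftrightarrow>
     (\<exists>D. (cc_vec n \<phi> V w has_derivative D) (at t within amplitudes CARD('n)) \<and>
          bij_betw D (amplitudes CARD('n)) (amplitudes CARD('n)))"

section \<open>Brouwer degree and index\<close>

text \<open>
  As in the homology library, \<open>\<real>\<^sup>m\<close> is represented by functions \<open>nat \<Rightarrow> real\<close> vanishing
  from index \<open>m\<close> on.  The degree \<open>deg(f, B(u,r), 0)\<close> of a continuous \<open>f\<close> without zeros on
  the boundary sphere is the degree of \<open>x \<mapsto> f(u + r x) / \<parallel>f(u + r x)\<parallel>\<close> as a self-map of
  the unit sphere.  In dimension \<open>0\<close> the sphere is empty and the degree is \<open>1\<close>.
\<close>

definition ball_degree ::
  "nat \<Rightarrow> ((nat \<Rightarrow> real) \<Rightarrow> nat \<Rightarrow> real) \<Rightarrow> (nat \<Rightarrow> real) \<Rightarrow> real \<Rightarrow> int" where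
  "ball_degree m f u r =
     (if m = 0 then 1
      else Brouwer_degree2 (m - 1)
             (\<lambda>x. let y = f (\<lambda>i. u i + r * x i)
                  in (\<lambda>i. if i < m then y i / sqrt (\<Sum>j<m. (y j)\<^sup>2) else 0)))"

definition zero_index ::
  "nat \<Rightarrow> ((nat \<Rightarrow> real) \<Rightarrow> nat \<Rightarrow> real) \<Rightarrow> (nat \<Rightarrow> real) \<Rightarrow> int" where
  "zero_index m f u = (THE d. \<forall>\<^sub>F r in at_right 0. ball_degree m f u r = d)"

text \<open>
  An enumeration \<open>e\<close> of the nonzero multiindices by \<open>{..<m}\<close> identifies the amplitude space with
  \<open>\<real>\<^sup>m\<close>, and its dual with \<open>\<real>\<^sup>m\<close> through the dual basis.
\<close>

definition to_coords :: "nat \<Rightarrow> (nat \<Rightarrow> 'k::{finite,linorder} set) \<Rightarrow> real^('k set) \<Rightarrow> nat \<Rightarrow> real" where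
  "to_coords m e t = (\<lambda>i. if i < m then t $ e i else 0)"

definition of_coords :: "nat \<Rightarrow> (nat \<Rightarrow> 'k::{finite,linorder} set) \<Rightarrow> (nat \<Rightarrow> real) \<Rightarrow> real^('k set)" where
  "of_coords m e x = (\<Sum>i<m. x i *\<^sub>R axis (e i) 1)"

definition cc_index ::
  "'n::{finite,linorder} itself \<Rightarrow> ('k::{finite,linorder} \<Rightarrow> real^3 \<Rightarrow> real) \<Rightarrow>
   (real^3 \<Rightarrow> real) \<Rightarrow> (real^3 \<Rightarrow> real) \<Rightarrow> (nat \<Rightarrow> 'k set) \<Rightarrow> real^('k set) \<Rightarrow> int" where
  "cc_index n \<phi> V w e t =
     (let m = card (excited CARD('n) :: 'k set set)
      in zero_index m (\<lambda>x. to_coords m e (cc_vec n \<phi> V w (of_coords m e x))) (to_coords m e t))"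

end

theory Submission
  imports Defs
begin

text \<open>
  At a zero of the coupled-cluster map, \<open>\<psi> = e\<^sup>T\<Phi>\<^sub>0\<close> satisfies \<open>H\<psi> = E\<psi>\<close>, and since cluster
  operators commute, the derivative there is, up to the signs relating \<open>X\<^sub>\<alpha>\<Phi>\<^sub>0\<close> to the ordered
  basis, the compression of \<open>e\<^sup>-\<^sup>T(H - E)e\<^sup>T\<close> to the orthogonal complement of \<open>\<Phi>\<^sub>0\<close>.
  The map \<open>s \<mapsto> P e\<^sup>TS\<Phi>\<^sub>0\<close>, with \<open>P\<close> the projection onto the orthogonal complement of \<open>\<psi>\<close>,
  conjugates it to \<open>H - E\<close> on that complement, which is diagonal in an orthonormal eigenbasis.
  So it is invertible iff \<open>E\<close> is simple, and the degree, being multiplicative and hence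
  invariant under conjugation, is the product of the signs of the numbers \<open>E\<^sub>j - E\<close>.
\<close>

section \<open>Sobolev regularity and orthonormality of Slater determinants\<close>

lemma measurable_vec_lambda:
  "(\<lambda>f. \<chi> i. f i) \<in> Pi\<^sub>M (UNIV::'n::finite set) (\<lambda>_. lborel :: 'a::euclidean_space measure) \<rightarrow>\<^sub>M borel"
proof (subst borel_measurable_euclidean_space, intro ballI)
  fix c :: "'a^'n" assume "c \<in> Basis"
  then obtain i b where c: "c = axis i b" "b \<in> Basis" by (auto simp: Basis_vec_def)
  have "(\<lambda>f. f i \<bullet> b) \<in> borel_measurable (Pi\<^sub>M (UNIV::'n set) (\<lambda>_. lborel :: 'a measure))"
    by measurable
  then show "(\<lambda>f. (\<chi> i. f i) \<bullet> c) \<in> borel_measurable (Pi\<^sub>M (UNIV::'n set) (\<lambda>_. lborel :: 'a measure))"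
    by (simp add: c inner_axis)
qed

lemma prod_Basis_vec:
  "(\<Prod>c\<in>(Basis :: ('a::euclidean_space^'n::finite) set). h c) = (\<Prod>i\<in>UNIV. \<Prod>b\<in>Basis. h (axis i b))"
proof -
  have B: "(Basis :: ('a^'n) set) = (\<lambda>(i,b). axis i b) ` (UNIV \<times> Basis)"
    by (auto simp: Basis_vec_def)
  have inj: "inj_on (\<lambda>(i,b). axis i b :: 'a^'n) (UNIV \<times> Basis)"
    by (auto simp: inj_on_def axis_eq_axis nonzero_Basis)
  show ?thesis
    unfolding B by (subst prod.reindex[OF inj]) (simp add: prod.cartesian_product case_prod_unfold)
qed

lemma lborel_vec:
  "(lborel :: ('a::euclidean_space^'n::finite) measure)
    = distr (Pi\<^sub>M (UNIV::'n set) (\<lambda>_. lborel)) borel (\<lambda>f. \<chi> i. f i)"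
proof (rule lborel_eqI)
  fix l u :: "'a^'n"
  assume le: "\<And>b. b \<in> Basis \<Longrightarrow> l \<bullet> b \<le> u \<bullet> b"
  interpret product_sigma_finite "\<lambda>_::'n. lborel :: 'a measure" by standard
  have le': "(l $ i) \<bullet> b \<le> (u $ i) \<bullet> b" if "b \<in> Basis" for i b
    using le[of "axis i b"] that by (simp add: axis_in_Basis_iff inner_axis)
  have pre: "(\<lambda>f. \<chi> i. f i) -` box l u \<inter> space (Pi\<^sub>M (UNIV::'n set) (\<lambda>_. lborel :: 'a measure))
      = Pi\<^sub>E UNIV (\<lambda>i. box (l $ i) (u $ i))"
    by (auto simp: space_PiM box_def Basis_vec_def inner_axis)
  have "emeasure (distr (Pi\<^sub>M (UNIV::'n set) (\<lambda>_. lborel)) borel (\<lambda>f. \<chi> i. f i)) (box l u)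
      = (\<Prod>i\<in>UNIV. emeasure lborel (box (l $ i) (u $ i)))"
    by (subst emeasure_distr[OF measurable_vec_lambda]) (auto simp: pre intro!: emeasure_PiM)
  also have "\<dots> = (\<Prod>i\<in>UNIV. ennreal (\<Prod>b\<in>Basis. (u $ i - l $ i) \<bullet> b))"
    by (intro prod.cong refl) (auto simp: emeasure_lborel_box_eq le')
  also have "\<dots> = ennreal (\<Prod>i\<in>UNIV. \<Prod>b\<in>Basis. (u $ i - l $ i) \<bullet> b)"
    by (intro prod_ennreal prod_nonneg) (auto simp: inner_diff_left le')
  also have "\<dots> = (\<Prod>b\<in>Basis. (u - l) \<bullet> b)"
    by (simp add: prod_Basis_vec inner_axis)
  finally show "emeasure (distr (Pi\<^sub>M (UNIV::'n set) (\<lambda>_. lborel)) borel (\<lambda>f. \<chi> i. f i)) (box l u)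
     = (\<Prod>b\<in>Basis. (u - l) \<bullet> b)" .
qed simp

lemma
  fixes F :: "('a::euclidean_space^'n::finite) \<Rightarrow> real"
  assumes "F \<in> borel_measurable borel"
  shows integrable_lborel_vec: "integrable lborel F \<longleftrightarrow> integrable (Pi\<^sub>M UNIV (\<lambda>_. lborel)) (\<lambda>f. F (\<chi> i. f i))"
    and integral_lborel_vec: "integral\<^sup>L lborel F = (\<integral>f. F (\<chi> i. f i) \<partial>Pi\<^sub>M UNIV (\<lambda>_. lborel))"
  using assms by (simp_all add: lborel_vec integrable_distr_eq[OF measurable_vec_lambda] integral_distr[OF measurable_vec_lambda])

lemma integral_lborel_vec_slice:
  fixes F :: "('a::euclidean_space^'n::finite) \<Rightarrow> real"
  assumes F: "integrable lborel F"
  shows "integral\<^sup>L lborel F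
     = (\<integral>x. (\<integral>y. F (\<chi> j. if j = i then y else x j) \<partial>lborel) \<partial>Pi\<^sub>M (UNIV - {i}) (\<lambda>_. lborel))"
proof -
  interpret product_sigma_finite "\<lambda>_::'n. lborel :: 'a measure" by standard
  have m: "F \<in> borel_measurable borel" using F by auto
  have I: "insert i (UNIV - {i}) = (UNIV :: 'n set)" by auto
  have "integrable (Pi\<^sub>M (insert i (UNIV - {i})) (\<lambda>_. lborel)) (\<lambda>f. F (\<chi> i. f i))"
    unfolding I using F integrable_lborel_vec[OF m] by simp
  from product_integral_insert[OF _ _ this] show ?thesis
    unfolding I integral_lborel_vec[OF m] by (simp add: fun_upd_def)
qed

definition tensor :: "('n::finite \<Rightarrow> 'a::euclidean_space \<Rightarrow> real) \<Rightarrow> 'a^'n \<Rightarrow> real" where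
  "tensor f x = (\<Prod>i\<in>UNIV. f i (x $ i))"

lemma borel_measurable_tensor:
  fixes f :: "'n::finite \<Rightarrow> 'a::euclidean_space \<Rightarrow> real"
  assumes "\<And>i. f i \<in> borel_measurable borel"
  shows "tensor f \<in> borel_measurable borel"
proof -
  have [measurable]: "(\<lambda>x::'a^'n. x $ i) \<in> borel_measurable borel" for i
    by (intro borel_measurable_continuous_onI continuous_intros)
  have [measurable]: "f i \<in> borel_measurable borel" for i by fact
  show ?thesis unfolding tensor_def[abs_def] by measurable
qed

lemma
  fixes f :: "'n::finite \<Rightarrow> 'a::euclidean_space \<Rightarrow> real"
  assumes f: "\<And>i. integrable lborel (f i)"
  shows integrable_tensor: "integrable lborel (tensor f)"
    and integral_tensor: "integral\<^sup>L lborel (tensor f) = (\<Prod>i\<in>UNIV. integral\<^sup>L lborel (f i))"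
proof -
  interpret product_sigma_finite "\<lambda>_::'n. lborel :: 'a measure" by standard
  have m: "tensor f \<in> borel_measurable borel"
    using f by (intro borel_measurable_tensor) auto
  show "integrable lborel (tensor f)"
    unfolding integrable_lborel_vec[OF m] using product_integrable_prod[OF _ f, of UNIV]
    by (simp add: tensor_def)
  show "integral\<^sup>L lborel (tensor f) = (\<Prod>i\<in>UNIV. integral\<^sup>L lborel (f i))"
    unfolding integral_lborel_vec[OF m] using product_integral_prod[OF _ f, of UNIV]
    by (simp add: tensor_def)
qed

lemma integrable_L2_mult:
  assumes "u \<in> L2" "v \<in> L2"
  shows "integrable lborel (\<lambda>x. u x * v x)"
proof (rule Bochner_Integration.integrable_bound)
  show "integrable lborel (\<lambda>x. (u x)\<^sup>2 + (v x)\<^sup>2)"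
    using assms by (auto simp: L2_def)
  show "(\<lambda>x. u x * v x) \<in> borel_measurable lborel"
    using assms by (auto simp: L2_def)
  have "\<bar>a * b\<bar> \<le> \<bar>a\<^sup>2 + b\<^sup>2\<bar>" for a b :: real
  proof -
    have "2 * (\<bar>a\<bar> * \<bar>b\<bar>) \<le> a\<^sup>2 + b\<^sup>2"
      using sum_squares_bound[of "\<bar>a\<bar>" "\<bar>b\<bar>"] by (simp add: mult.assoc)
    moreover have "0 \<le> \<bar>a\<bar> * \<bar>b\<bar>" "0 \<le> a\<^sup>2 + b\<^sup>2" by simp_all
    ultimately show ?thesis unfolding abs_mult by linarith
  qed
  then show "AE x in lborel. norm (u x * v x) \<le> norm ((u x)\<^sup>2 + (v x)\<^sup>2)"
    by simp
qed

lemma L2_linear: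
  assumes "u \<in> L2" "v \<in> L2"
  shows "(\<lambda>x. a * u x + v x) \<in> L2"
proof -
  have "integrable lborel (\<lambda>x. a\<^sup>2 * (u x)\<^sup>2 + 2 * a * (u x * v x) + (v x)\<^sup>2)"
    using assms integrable_L2_mult[OF assms] by (auto simp: L2_def)
  moreover have "(\<lambda>x. (a * u x + v x)\<^sup>2) = (\<lambda>x. a\<^sup>2 * (u x)\<^sup>2 + 2 * a * (u x * v x) + (v x)\<^sup>2)"
    by (auto simp: power2_eq_square algebra_simps)
  ultimately show ?thesis using assms by (auto simp: L2_def)
qed

lemma tensor_L2:
  assumes "\<And>i. f i \<in> L2"
  shows "tensor f \<in> L2"
proof -
  have "integrable lborel (tensor (\<lambda>i x. (f i x)\<^sup>2))"
    using assms by (intro integrable_tensor) (auto simp: L2_def)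
  then show ?thesis
    using assms borel_measurable_tensor[of f] by (auto simp: L2_def tensor_def[abs_def] prod_power_distrib)
qed

lemma L2_inner_tensor:
  assumes "\<And>i. f i \<in> L2" "\<And>i. g i \<in> L2"
  shows "L2_inner (tensor f) (tensor g) = (\<Prod>i\<in>UNIV. L2_inner (f i) (g i))"
  using integral_tensor[of "\<lambda>i x. f i x * g i x"] integrable_L2_mult[OF assms]
  by (simp add: L2_inner_def tensor_def[abs_def] prod.distrib)

lemma C_k_imp_continuous: "C_k k f \<Longrightarrow> continuous_on UNIV f"
  by (cases k) (auto intro: differentiable_imp_continuous_on)

lemma test_function_L2:
  assumes "test_function \<eta>"
  shows "\<eta> \<in> L2"
proof -
  from assms obtain C where C: "compact C" "\<And>x. x \<notin> C \<Longrightarrow> \<eta> x = 0"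
    by (auto simp: test_function_def)
  have c: "continuous_on UNIV \<eta>"
    using assms by (auto simp: test_function_def intro: C_k_imp_continuous)
  then have "continuous_on C (\<lambda>x. (\<eta> x)\<^sup>2)"
    by (intro continuous_intros) (auto intro: continuous_on_subset)
  from borel_integrable_compact[OF C(1) this]
  have "integrable lborel (\<lambda>x. indicator C x *\<^sub>R (\<eta> x)\<^sup>2)" .
  moreover have "(\<lambda>x. indicator C x *\<^sub>R (\<eta> x)\<^sup>2) = (\<lambda>x. (\<eta> x)\<^sup>2)"
    using C(2) by (fastforce simp: indicator_def)
  ultimately show ?thesis
    using borel_measurable_continuous_onI[OF c] by (auto simp: L2_def)
qed

lemma test_function_partial:
  assumes \<eta>: "test_function \<eta>" and b: "b \<in> Basis"
  shows "test_function (\<lambda>x. frechet_derivative \<eta> (at x) b)"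
proof -
  from \<eta> obtain C where C: "compact C" "\<And>x. x \<notin> C \<Longrightarrow> \<eta> x = 0"
    by (auto simp: test_function_def)
  have "C_k k (\<lambda>x. frechet_derivative \<eta> (at x) b)" for k
    using \<eta> b by (auto simp: test_function_def dest!: spec[of _ "Suc k"])
  moreover have "frechet_derivative \<eta> (at x) b = 0" if "x \<notin> C" for x
  proof -
    have "(\<eta> has_derivative (\<lambda>_. 0)) (at x)"
    proof (rule has_derivative_transform_within_open[where s = "- C" and f = "\<lambda>_. 0"])
      show "open (- C)" using C(1) by (simp add: compact_imp_closed open_Compl)
    qed (use that C in auto)
    from frechet_derivative_at[OF this] show ?thesis by (simp add: fun_eq_iff)
  qed
  ultimately show ?thesis using C(1) by (auto simp: test_function_def)
qed

lemma has_weak_partial_linear: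
  assumes b: "b \<in> Basis" and L2: "u \<in> L2" "v \<in> L2" "g \<in> L2" "h \<in> L2"
    and u: "has_weak_partial u b g" and v: "has_weak_partial v b h"
  shows "has_weak_partial (\<lambda>x. a * u x + v x) b (\<lambda>x. a * g x + h x)"
  unfolding has_weak_partial_def
proof (intro allI impI)
  fix \<eta> :: "'a \<Rightarrow> real" assume \<eta>: "test_function \<eta>"
  note [simp] = integrable_L2_mult[OF _ test_function_L2[OF \<eta>]]
    integrable_L2_mult[OF _ test_function_L2[OF test_function_partial[OF \<eta> b]]]
  show "(\<integral>x. (a * u x + v x) * frechet_derivative \<eta> (at x) b \<partial>lborel) = - (\<integral>x. (a * g x + h x) * \<eta> x \<partial>lborel)"
    using u v \<eta> L2 by (simp add: has_weak_partial_def distrib_right mult.assoc)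
qed

lemma bounded_linear_axis: "bounded_linear (axis i :: 'a::euclidean_space \<Rightarrow> 'a^'n::finite)"
  by (auto simp: linear_conv_bounded_linear[symmetric] axis_def vec_eq_iff intro!: linearI)

lemma C_k_slice:
  fixes \<eta> :: "('a::euclidean_space^'n::finite) \<Rightarrow> real"
  assumes "C_k k \<eta>"
  shows "C_k k (\<lambda>y. \<eta> (a + axis i y))"
  using assms
proof (induction k arbitrary: \<eta>)
  case 0
  then show ?case
    by (auto intro!: continuous_intros continuous_on_compose2[of UNIV \<eta>] bounded_linear.continuous_on[OF bounded_linear_axis])
next
  case (Suc k)
  have d: "(\<eta> has_derivative frechet_derivative \<eta> (at x)) (at x)" for x
    using Suc.prems by (auto simp: differentiable_on_def frechet_derivative_works)
  have D: "((\<lambda>y. \<eta> (a + axis i y)) has_derivative (\<lambda>h. frechet_derivative \<eta> (at (a + axis i y)) (axis i h))) (at y)" for y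
    by (rule has_derivative_compose[OF _ d])
      (auto intro!: derivative_eq_intros bounded_linear_imp_has_derivative[OF bounded_linear_axis])
  have "frechet_derivative (\<lambda>y. \<eta> (a + axis i y)) (at y) b = frechet_derivative \<eta> (at (a + axis i y)) (axis i b)" for y b
    using frechet_derivative_at[OF D[of y]] by metis
  moreover have "C_k k (\<lambda>y. frechet_derivative \<eta> (at (a + axis i y)) (axis i b))" if "b \<in> Basis" for b
    using Suc.prems that by (intro Suc.IH[of "\<lambda>x. frechet_derivative \<eta> (at x) (axis i b)"]) simp
  moreover have "(\<lambda>y. \<eta> (a + axis i y)) differentiable_on UNIV"
    unfolding differentiable_on_def differentiable_def using D by auto
  ultimately show ?case by simp
qed

lemma
  fixes \<eta> :: "('a::euclidean_space^'n::finite) \<Rightarrow> real"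
  assumes \<eta>: "test_function \<eta>"
  shows test_function_slice: "test_function (\<lambda>y. \<eta> (a + axis i y))"
    and frechet_derivative_slice: "frechet_derivative (\<lambda>y. \<eta> (a + axis i y)) (at y) b
        = frechet_derivative \<eta> (at (a + axis i y)) (axis i b)"
proof -
  from \<eta> obtain C where C: "compact C" "\<And>x. x \<notin> C \<Longrightarrow> \<eta> x = 0"
    by (auto simp: test_function_def)
  have "compact ((\<lambda>x. x $ i - a $ i) ` C)"
    by (intro compact_continuous_image C continuous_intros)
  moreover have "\<eta> (a + axis i y) = 0" if "y \<notin> (\<lambda>x. x $ i - a $ i) ` C" for y
  proof (rule C(2), rule)
    assume "a + axis i y \<in> C"
    then have "(a + axis i y) $ i - a $ i \<in> (\<lambda>x. x $ i - a $ i) ` C" by blast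
    with that show False by simp
  qed
  ultimately show "test_function (\<lambda>y. \<eta> (a + axis i y))"
    using \<eta> C_k_slice[of _ \<eta> a i] unfolding test_function_def by blast
  have "C_k 1 \<eta>" using \<eta> by (auto simp: test_function_def)
  then have d: "(\<eta> has_derivative frechet_derivative \<eta> (at x)) (at x)" for x
    by (auto simp: differentiable_on_def frechet_derivative_works)
  have D: "((\<lambda>y. \<eta> (a + axis i y)) has_derivative (\<lambda>h. frechet_derivative \<eta> (at (a + axis i y)) (axis i h))) (at y)"
    by (rule has_derivative_compose[OF _ d])
      (auto intro!: derivative_eq_intros bounded_linear_imp_has_derivative[OF bounded_linear_axis])
  show "frechet_derivative (\<lambda>y. \<eta> (a + axis i y)) (at y) b = frechet_derivative \<eta> (at (a + axis i y)) (axis i b)"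
    using frechet_derivative_at[OF D] by metis
qed

lemma has_weak_partial_tensor:
  fixes f :: "'n::finite \<Rightarrow> 'a::euclidean_space \<Rightarrow> real"
  assumes f: "\<And>i. f i \<in> L2" and g: "g \<in> L2" and b: "b \<in> Basis" and w: "has_weak_partial (f i) b g"
  shows "has_weak_partial (tensor f) (axis i b) (tensor (f(i := g)))"
  unfolding has_weak_partial_def
proof (intro allI impI)
  fix \<eta> :: "'a^'n \<Rightarrow> real" assume \<eta>: "test_function \<eta>"
  have B: "axis i b \<in> (Basis :: ('a^'n) set)" using b by (simp add: axis_in_Basis_iff)
  have f': "tensor (f(i := g)) \<in> L2" using f g by (intro tensor_L2) auto
  define P where "P = (\<lambda>x::'n \<Rightarrow> 'a. \<Prod>j\<in>UNIV - {i}. f j (x j))"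
  define a where "a = (\<lambda>x::'n \<Rightarrow> 'a. (\<chi> j. if j = i then 0 else x j))"
  have s: "(\<chi> j. if j = i then y else x j) = a x + axis i y" for x y
    by (auto simp: a_def vec_eq_iff axis_def)
  have t: "tensor h (a x + axis i y) = h i y * (\<Prod>j\<in>UNIV - {i}. h j (x j))" for x y and h :: "'n \<Rightarrow> 'a \<Rightarrow> real"
    unfolding tensor_def by (subst prod.remove[of _ i]) (auto simp: a_def axis_def intro!: prod.cong)
  have t1: "tensor f (a x + axis i y) = P x * f i y" for x y
    by (simp add: t P_def)
  have t2: "tensor (f(i := g)) (a x + axis i y) = P x * g y" for x y
    unfolding t P_def by (auto intro!: prod.cong)
  have key: "(\<integral>y. f i y * frechet_derivative \<eta> (at (a x + axis i y)) (axis i b) \<partial>lborel)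
      = - (\<integral>y. g y * \<eta> (a x + axis i y) \<partial>lborel)" for x
    using w test_function_slice[OF \<eta>, of "a x" i]
    unfolding has_weak_partial_def by (auto simp: frechet_derivative_slice[OF \<eta>])
  have "(\<integral>x. tensor f x * frechet_derivative \<eta> (at x) (axis i b) \<partial>lborel)
     = (\<integral>x. P x * (\<integral>y. f i y * frechet_derivative \<eta> (at (a x + axis i y)) (axis i b) \<partial>lborel) \<partial>Pi\<^sub>M (UNIV - {i}) (\<lambda>_. lborel))"
    unfolding integral_lborel_vec_slice[OF integrable_L2_mult[OF tensor_L2[OF f] test_function_L2[OF test_function_partial[OF \<eta> B]]], where i = i]
    by (simp add: s t1 mult.assoc)
  also have "\<dots> = - (\<integral>x. P x * (\<integral>y. g y * \<eta> (a x + axis i y) \<partial>lborel) \<partial>Pi\<^sub>M (UNIV - {i}) (\<lambda>_. lborel))"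
    by (simp add: key)
  also have "\<dots> = - (\<integral>x. tensor (f(i := g)) x * \<eta> x \<partial>lborel)"
    unfolding integral_lborel_vec_slice[OF integrable_L2_mult[OF f' test_function_L2[OF \<eta>]], where i = i]
    by (simp add: s t2 mult.assoc)
  finally show "(\<integral>x. tensor f x * frechet_derivative \<eta> (at x) (axis i b) \<partial>lborel) = - (\<integral>x. tensor (f(i := g)) x * \<eta> x \<partial>lborel)" .
qed

lemma sobolev_imp_L2: "u \<in> sobolev k \<Longrightarrow> u \<in> L2"
  by (cases k) auto

lemma sobolev_Suc_imp: "u \<in> sobolev (Suc k) \<Longrightarrow> u \<in> sobolev k"
  by (induction k arbitrary: u) (auto, blast)

lemma sobolev_linear:
  "u \<in> sobolev k \<Longrightarrow> v \<in> sobolev k \<Longrightarrow> (\<lambda>x. a * u x + v x) \<in> sobolev k"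
proof (induction k arbitrary: u v)
  case 0
  then show ?case by (auto intro: L2_linear)
next
  case (Suc k)
  have "\<exists>p\<in>sobolev k. has_weak_partial (\<lambda>x. a * u x + v x) b p" if b: "b \<in> Basis" for b
  proof -
    from Suc.prems(1) b obtain g where "g \<in> sobolev k" "has_weak_partial u b g" by auto
    moreover from Suc.prems(2) b obtain h where "h \<in> sobolev k" "has_weak_partial v b h" by auto
    ultimately show ?thesis
      using Suc.prems b Suc.IH
      by (intro bexI[of _ "\<lambda>x. a * g x + h x"] has_weak_partial_linear) (auto intro: sobolev_imp_L2)
  qed
  with Suc.prems show ?case by (auto intro: L2_linear)
qed

lemma sobolev_zero: "(\<lambda>x. 0) \<in> sobolev k"
  by (induction k) (auto simp: L2_def has_weak_partial_def intro!: bexI[of _ "\<lambda>x. 0"])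

lemma sobolev_sum:
  "finite A \<Longrightarrow> (\<And>i. i \<in> A \<Longrightarrow> f i \<in> sobolev k) \<Longrightarrow> (\<lambda>x. \<Sum>i\<in>A. c i * f i x) \<in> sobolev k"
  by (induction A rule: finite_induct) (auto intro: sobolev_zero sobolev_linear)

lemma sobolev_tensor:
  "(\<And>i. f i \<in> sobolev k) \<Longrightarrow> tensor f \<in> sobolev k"
proof (induction k arbitrary: f)
  case 0
  then show ?case by (simp add: tensor_L2)
next
  case (Suc k)
  have L2: "f i \<in> L2" for i using Suc.prems[of i] by simp
  have "\<exists>p\<in>sobolev k. has_weak_partial (tensor f) c p" if "c \<in> Basis" for c
  proof -
    from that obtain i b where c: "c = axis i b" "b \<in> Basis" by (auto simp: Basis_vec_def)
    with Suc.prems[of i] obtain g where g: "g \<in> sobolev k" "has_weak_partial (f i) b g" by auto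
    show ?thesis
      unfolding c using g c(2) Suc.prems
      by (intro bexI[of _ "tensor (f(i := g))"] has_weak_partial_tensor Suc.IH L2)
        (auto intro: sobolev_imp_L2 sobolev_Suc_imp simp del: sobolev.simps)
  qed
  with L2 show ?case by (simp add: tensor_L2)
qed


lemma L2_inner_sum:
  assumes "finite A" "finite B" "\<And>i. i \<in> A \<Longrightarrow> f i \<in> L2" "\<And>j. j \<in> B \<Longrightarrow> g j \<in> L2"
  shows "L2_inner (\<lambda>x. \<Sum>i\<in>A. a i * f i x) (\<lambda>x. \<Sum>j\<in>B. b j * g j x)
    = (\<Sum>i\<in>A. \<Sum>j\<in>B. a i * b j * L2_inner (f i) (g j))"
proof -
  have "L2_inner (\<lambda>x. \<Sum>i\<in>A. a i * f i x) (\<lambda>x. \<Sum>j\<in>B. b j * g j x)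
     = (\<integral>x. (\<Sum>i\<in>A. \<Sum>j\<in>B. a i * b j * (f i x * g j x)) \<partial>lborel)"
    unfolding L2_inner_def by (simp add: sum_product mult_ac)
  also have "\<dots> = (\<Sum>i\<in>A. \<Sum>j\<in>B. a i * b j * L2_inner (f i) (g j))"
    unfolding L2_inner_def using assms by (simp add: Bochner_Integration.integral_sum integrable_L2_mult)
  finally show ?thesis .
qed

definition orbital :: "'k::{finite,linorder} set \<Rightarrow> 'n::{finite,linorder} \<Rightarrow> 'k" where
  "orbital \<alpha> j = sorted_list_of_set \<alpha> ! card {l. l < j}"

lemma bij_betw_rank: "bij_betw (\<lambda>j::'n::{finite,linorder}. card {l. l < j}) UNIV {..<CARD('n)}"
proof -
  have mono: "card {l. l < i} < card {l. l < j}" if "i < j" for i j :: 'n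
    by (rule psubset_card_mono) (use that in auto)
  have inj: "inj (\<lambda>j::'n. card {l. l < j})"
    by (rule injI) (metis mono less_irrefl linorder_cases)
  have "(\<lambda>j::'n. card {l. l < j}) ` UNIV \<subseteq> {..<CARD('n)}"
    by (auto intro!: psubset_card_mono)
  with inj show ?thesis
    by (simp add: bij_betw_def card_image card_subset_eq)
qed

lemma bij_betw_orbital:
  assumes "card \<alpha> = CARD('n::{finite,linorder})"
  shows "bij_betw (orbital \<alpha> :: 'n \<Rightarrow> 'k::{finite,linorder}) UNIV \<alpha>"
proof -
  have "bij_betw ((!) (sorted_list_of_set \<alpha>)) {..<CARD('n)} \<alpha>"
    by (rule bij_betw_nth) (auto simp: assms)
  from bij_betw_trans[OF bij_betw_rank this] show ?thesis
    by (simp add: orbital_def[abs_def] comp_def)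
qed

lemma slater_eq_sum:
  "(slater \<phi> \<alpha> :: 'n::{finite,linorder} config \<Rightarrow> real) =
    (\<lambda>x. \<Sum>p | p permutes UNIV. (of_int (sign p) / sqrt (fact CARD('n))) * tensor (\<lambda>i. \<phi> (orbital \<alpha> (p i))) x)"
  by (auto simp: slater_def det_def tensor_def orbital_def sum_divide_distrib fun_eq_iff)

lemma slater_sobolev:
  assumes "\<And>p. \<phi> p \<in> sobolev k"
  shows "slater \<phi> \<alpha> \<in> sobolev k"
  unfolding slater_eq_sum using assms by (intro sobolev_sum sobolev_tensor) (auto simp: finite_permutations)

lemma slater_antisymmetric:
  assumes "\<sigma> permutes UNIV"
  shows "slater \<phi> \<alpha> (\<chi> i. x $ \<sigma> i) = of_int (sign \<sigma>) * slater \<phi> \<alpha> x"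
proof -
  have "(\<chi> i j. \<phi> (sorted_list_of_set \<alpha> ! card {l. l < j}) ((\<chi> i. x $ \<sigma> i) $ i))
     = (\<chi> i. (\<chi> i j. \<phi> (sorted_list_of_set \<alpha> ! card {l. l < j}) (x $ i)) $ \<sigma> i)"
    by (simp add: vec_eq_iff)
  then show ?thesis
    unfolding slater_def by (simp add: det_permute_rows[OF assms, where A = "\<chi> i j. \<phi> (sorted_list_of_set \<alpha> ! card {l. l < j}) (x $ i)", simplified])
qed

lemma wavefunction_sobolev:
  assumes "\<And>p. \<phi> p \<in> sobolev k"
  shows "(wavefunction \<phi> c :: 'n::{finite,linorder} config \<Rightarrow> real) \<in> antisymmetric_sobolev k"
proof -
  have "wavefunction \<phi> c \<in> (sobolev k :: ('n config \<Rightarrow> real) set)"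
    unfolding wavefunction_def[abs_def] using assms by (intro sobolev_sum slater_sobolev) auto
  moreover have "wavefunction \<phi> c (\<chi> i. x $ \<sigma> i) = of_int (sign \<sigma>) * wavefunction \<phi> c x"
    if "\<sigma> permutes UNIV" for \<sigma> and x :: "'n config"
    by (simp add: wavefunction_def slater_antisymmetric[OF that] sum_distrib_left mult.left_commute)
  ultimately show ?thesis
    by (auto simp: antisymmetric_sobolev_def antisymmetric_L2_def intro: sobolev_imp_L2)
qed

lemma L2_inner_slater:
  fixes \<phi> :: "'k::{finite,linorder} \<Rightarrow> real^3 \<Rightarrow> real"
  assumes L2: "\<And>p. \<phi> p \<in> L2"
    and on: "\<And>p q. L2_inner (\<phi> p) (\<phi> q) = (if p = q then 1 else 0)"
    and \<alpha>: "card \<alpha> = CARD('n::{finite,linorder})" and \<beta>: "card \<beta> = CARD('n)"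
  shows "L2_inner (slater \<phi> \<alpha> :: 'n config \<Rightarrow> real) (slater \<phi> \<beta>) = (if \<alpha> = \<beta> then 1 else 0)"
proof -
  define P where "P = {p. p permutes (UNIV :: 'n set)}"
  have fin: "finite P" by (simp add: P_def finite_permutations)
  have I: "L2_inner (tensor (\<lambda>i. \<phi> (orbital \<alpha> (p i))) :: 'n config \<Rightarrow> real) (tensor (\<lambda>i. \<phi> (orbital \<beta> (q i))))
     = (if \<alpha> = \<beta> \<and> p = q then 1 else 0)" if "p \<in> P" "q \<in> P" for p q
  proof -
    have p: "bij p" and q: "bij q" using that by (auto simp: P_def permutes_bij)
    have "L2_inner (tensor (\<lambda>i. \<phi> (orbital \<alpha> (p i))) :: 'n config \<Rightarrow> real) (tensor (\<lambda>i. \<phi> (orbital \<beta> (q i))))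
       = (\<Prod>i\<in>UNIV. if orbital \<alpha> (p i) = orbital \<beta> (q i) then 1 else 0)"
      by (simp add: L2_inner_tensor L2 on)
    also have "\<dots> = (if \<forall>i. orbital \<alpha> (p i) = orbital \<beta> (q i) then 1 else 0)"
      by auto
    also have "(\<forall>i. orbital \<alpha> (p i) = orbital \<beta> (q i)) \<longleftrightarrow> \<alpha> = \<beta> \<and> p = q"
    proof
      assume eq: "\<forall>i. orbital \<alpha> (p i) = orbital \<beta> (q i)"
      have "\<alpha> = range (orbital \<alpha> :: 'n \<Rightarrow> 'k)" "\<beta> = range (orbital \<beta> :: 'n \<Rightarrow> 'k)"
        using bij_betw_orbital[OF \<alpha>] bij_betw_orbital[OF \<beta>] by (auto simp: bij_betw_def)
      moreover have "range (\<lambda>i. orbital \<alpha> (p i)) = range (orbital \<alpha> :: 'n \<Rightarrow> 'k)"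
        using bij_is_surj[OF p] by (simp add: image_image[symmetric])
      moreover have "range (\<lambda>i. orbital \<beta> (q i)) = range (orbital \<beta> :: 'n \<Rightarrow> 'k)"
        using bij_is_surj[OF q] by (simp add: image_image[symmetric])
      ultimately have ab: "\<alpha> = \<beta>" using eq by simp
      moreover have "p = q"
      proof
        fix i
        have "orbital \<alpha> (p i) = orbital \<alpha> (q i)" using eq ab by simp
        then show "p i = q i"
          using bij_betw_orbital[OF \<alpha>] by (auto simp: bij_betw_def inj_on_def)
      qed
      ultimately show "\<alpha> = \<beta> \<and> p = q" ..
    qed auto
    finally show ?thesis .
  qed
  have "L2_inner (slater \<phi> \<alpha> :: 'n config \<Rightarrow> real) (slater \<phi> \<beta>)
     = (\<Sum>p\<in>P. \<Sum>q\<in>P. of_int (sign p) / sqrt (fact CARD('n)) * (of_int (sign q) / sqrt (fact CARD('n)))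
         * (if \<alpha> = \<beta> \<and> p = q then 1 else 0))"
    unfolding slater_eq_sum P_def[symmetric]
    by (subst L2_inner_sum[OF fin fin]) (auto simp: I intro!: tensor_L2 L2 sum.cong)
  also have "\<dots> = (if \<alpha> = \<beta> then \<Sum>p\<in>P. (of_int (sign p))\<^sup>2 / fact CARD('n) else 0)"
    using fin by (auto simp: if_distrib[where f = "\<lambda>x. _ * x"] power2_eq_square cong: if_cong)
  also have "(\<Sum>p\<in>P. (of_int (sign p))\<^sup>2 / fact CARD('n)) = (1::real)"
  proof -
    have "(of_int (sign p))\<^sup>2 = (1::real)" for p :: "'n \<Rightarrow> 'n" by (auto simp: sign_def)
    moreover have "card P = fact CARD('n)" by (simp add: P_def card_permutations)
    ultimately show ?thesis by simp
  qed
  finally show ?thesis by simp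
qed

lemma L2_inner_wavefunction:
  fixes \<phi> :: "'k::{finite,linorder} \<Rightarrow> real^3 \<Rightarrow> real"
  assumes L2: "\<And>p. \<phi> p \<in> L2"
    and on: "\<And>p q. L2_inner (\<phi> p) (\<phi> q) = (if p = q then 1 else 0)"
  shows "L2_inner (wavefunction \<phi> c :: 'n::{finite,linorder} config \<Rightarrow> real) (wavefunction \<phi> d)
    = (\<Sum>\<alpha> | card \<alpha> = CARD('n). c $ \<alpha> * d $ \<alpha>)"
proof -
  have s: "(slater \<phi> \<alpha> :: 'n config \<Rightarrow> real) \<in> L2" for \<alpha>
    using slater_sobolev[of \<phi> 0] L2 by simp
  have "L2_inner (wavefunction \<phi> c :: 'n config \<Rightarrow> real) (wavefunction \<phi> d)
     = (\<Sum>\<alpha> | card \<alpha> = CARD('n). \<Sum>\<beta> | card \<beta> = CARD('n). c $ \<alpha> * d $ \<beta> * (if \<alpha> = \<beta> then 1 else 0))"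
    unfolding wavefunction_def[abs_def]
    by (subst L2_inner_sum) (auto simp: s L2_inner_slater[OF L2 on] intro!: sum.cong)
  also have "\<dots> = (\<Sum>\<alpha> | card \<alpha> = CARD('n). c $ \<alpha> * d $ \<alpha>)"
    by (auto simp: if_distrib[where f = "\<lambda>x. _ * x"] cong: if_cong intro!: sum.cong)
  finally show ?thesis .
qed

lemma wavefunction_eqD:
  fixes \<phi> :: "'k::{finite,linorder} \<Rightarrow> real^3 \<Rightarrow> real"
  assumes L2: "\<And>p. \<phi> p \<in> L2"
    and on: "\<And>p q. L2_inner (\<phi> p) (\<phi> q) = (if p = q then 1 else 0)"
    and eq: "(wavefunction \<phi> c :: 'n::{finite,linorder} config \<Rightarrow> real) = wavefunction \<phi> d"
    and c: "c \<in> sector CARD('n)" and d: "d \<in> sector CARD('n)"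
  shows "c = d"
proof -
  have "c $ \<alpha> = d $ \<alpha>" for \<alpha>
  proof (cases "card \<alpha> = CARD('n)")
    case True
    have *: "L2_inner (wavefunction \<phi> x :: 'n config \<Rightarrow> real) (wavefunction \<phi> (axis \<alpha> 1)) = x $ \<alpha>" for x
      unfolding L2_inner_wavefunction[OF L2 on] using True by (simp add: axis_def if_distrib[where f = "\<lambda>x. _ * x"] cong: if_cong)
    show ?thesis using *[of c] *[of d] eq by simp
  qed (use c d in \<open>auto simp: sector_def\<close>)
  then show ?thesis by (simp add: vec_eq_iff)
qed

section \<open>Cluster operators on Fock space\<close>

definition jordan_wigner :: "'k::{finite,linorder} \<Rightarrow> 'k set \<Rightarrow> real" where
  "jordan_wigner p S = (-1) ^ card {q\<in>S. q < p}"

lemma jordan_wigner_insert: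
  assumes "r \<notin> S"
  shows "jordan_wigner p (insert r S) = (if r < p then - jordan_wigner p S else jordan_wigner p S)"
proof -
  have "{q \<in> insert r S. q < p} = (if r < p then insert r {q\<in>S. q < p} else {q\<in>S. q < p})" by auto
  with assms show ?thesis by (simp add: jordan_wigner_def)
qed

lemma jordan_wigner_remove:
  assumes "r \<in> S"
  shows "jordan_wigner p (S - {r}) = (if r < p then - jordan_wigner p S else jordan_wigner p S)"
  using jordan_wigner_insert[of r "S - {r}" p] assms by (auto simp: insert_absorb)

lemma jordan_wigner_square: "jordan_wigner p S * jordan_wigner p S = 1"
  by (simp add: jordan_wigner_def power_mult_distrib[symmetric])

lemma creation_nth: "creation p c $ S = (if p \<in> S then jordan_wigner p S * c $ (S - {p}) else 0)"
  by (simp add: creation_def jordan_wigner_def)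

lemma annihilation_nth: "annihilation p c $ S = (if p \<notin> S then jordan_wigner p S * c $ (insert p S) else 0)"
  by (simp add: annihilation_def jordan_wigner_def)

lemma linear_creation: "linear (creation p)"
  by (rule linearI) (simp_all add: vec_eq_iff creation_nth algebra_simps)

lemma linear_annihilation: "linear (annihilation p)"
  by (rule linearI) (simp_all add: vec_eq_iff annihilation_nth algebra_simps)

lemma creation_anticommute: "creation p (creation q c) = - creation q (creation p c)"
proof -
  have nth: "creation p (creation q c) $ S
      = (if p \<in> S \<and> q \<in> S \<and> p \<noteq> q then jordan_wigner p S * jordan_wigner q (S - {p}) * c $ (S - {p, q}) else 0)" for p q S
    by (auto simp: creation_nth Diff_insert2[of S p "{q}"])
  show ?thesis
    by (cases p q rule: linorder_cases) (auto simp: vec_eq_iff nth jordan_wigner_remove insert_commute)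
qed

lemma annihilation_anticommute: "annihilation p (annihilation q c) = - annihilation q (annihilation p c)"
proof -
  have nth: "annihilation p (annihilation q c) $ S
      = (if p \<notin> S \<and> q \<notin> S \<and> p \<noteq> q then jordan_wigner p S * jordan_wigner q (insert p S) * c $ ({p, q} \<union> S) else 0)" for p q S
    by (auto simp: annihilation_nth insert_commute)
  show ?thesis
    by (cases p q rule: linorder_cases) (auto simp: vec_eq_iff nth jordan_wigner_insert insert_commute)
qed

lemma creation_annihilation_anticommute:
  assumes "p \<noteq> q"
  shows "creation p (annihilation q c) = - annihilation q (creation p c)"
proof -
  have "insert q (S - {p}) = insert q S - {p}" for S using assms by auto
  then have 1: "creation p (annihilation q c) $ S
      = (if p \<in> S \<and> q \<notin> S then jordan_wigner p S * jordan_wigner q (S - {p}) * c $ (insert q S - {p}) else 0)" for S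
    using assms by (auto simp: creation_nth annihilation_nth)
  have 2: "annihilation q (creation p c) $ S
      = (if p \<in> S \<and> q \<notin> S then jordan_wigner q S * jordan_wigner p (insert q S) * c $ (insert q S - {p}) else 0)" for S
    using assms by (auto simp: creation_nth annihilation_nth)
  show ?thesis
    using assms by (cases p q rule: linorder_cases)
      (auto simp: vec_eq_iff 1 2 jordan_wigner_insert jordan_wigner_remove)
qed

definition hop :: "'k::{finite,linorder} \<Rightarrow> 'k \<Rightarrow> 'k fock \<Rightarrow> 'k fock" where
  "hop A I c = creation A (annihilation I c)"

lemma linear_hop: "linear (hop A I)"
  using linear_compose[OF linear_annihilation linear_creation, of A I] by (simp add: hop_def[abs_def] comp_def)

lemma hop_commute:
  assumes "A \<noteq> J" "B \<noteq> I"
  shows "hop A I (hop B J c) = hop B J (hop A I c)"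
proof -
  note neg = linear_neg[OF linear_creation] linear_neg[OF linear_annihilation]
  have AB: "creation A (creation B x) = - creation B (creation A x)" for x
    by (rule creation_anticommute)
  have IJ: "annihilation I (annihilation J x) = - annihilation J (annihilation I x)" for x
    by (rule annihilation_anticommute)
  have IB: "annihilation I (creation B x) = - creation B (annihilation I x)"
    and JA: "annihilation J (creation A x) = - creation A (annihilation J x)" for x
    using creation_annihilation_anticommute[of B I x] creation_annihilation_anticommute[of A J x] assms by auto
  have "hop A I (hop B J c) = - creation A (creation B (annihilation I (annihilation J c)))"
    by (simp only: hop_def IB neg)
  also have "\<dots> = creation B (creation A (annihilation I (annihilation J c)))"
    by (simp only: AB[of "annihilation I (annihilation J c)"] minus_minus)
  also have "\<dots> = - creation B (creation A (annihilation J (annihilation I c)))"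
    by (simp only: IJ[of c] neg)
  also have "\<dots> = hop B J (hop A I c)"
    by (simp only: hop_def JA neg)
  finally show ?thesis .
qed

lemma hop_nth_nonzero:
  assumes "hop A I c $ S \<noteq> 0" "A \<noteq> I"
  shows "A \<in> S" "I \<notin> S" "c $ insert I (S - {A}) \<noteq> 0"
  using assms by (auto simp: hop_def creation_nth annihilation_nth split: if_splits)

lemma hop_axis:
  assumes "I \<in> S" "A \<notin> S"
  shows "hop A I (axis S 1) = (jordan_wigner I (S - {I}) * jordan_wigner A (insert A (S - {I}))) *\<^sub>R axis (insert A (S - {I})) 1"
proof -
  have "annihilation I (axis S 1) = jordan_wigner I (S - {I}) *\<^sub>R axis (S - {I}) 1"
    using assms by (auto simp: vec_eq_iff annihilation_nth axis_def)
  moreover have "creation A (axis (S - {I}) 1) = jordan_wigner A (insert A (S - {I})) *\<^sub>R axis (insert A (S - {I})) 1"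
    using assms by (auto simp: vec_eq_iff creation_nth axis_def)
  ultimately show ?thesis
    by (simp add: hop_def linear_cmul[OF linear_creation])
qed

definition hops :: "('k::{finite,linorder} \<times> 'k) list \<Rightarrow> 'k fock \<Rightarrow> 'k fock" where
  "hops zs = foldr (\<lambda>(A, I) F. creation A \<circ> annihilation I \<circ> F) zs id"

lemma hops_Nil: "hops [] c = c" and hops_Cons: "hops (z # zs) c = hop (fst z) (snd z) (hops zs c)"
  by (simp_all add: hops_def hop_def split: prod.split)

lemma excitation_eq_hops:
  "excitation N \<alpha> = hops (zip (sorted_list_of_set (\<alpha> - occupied N)) (sorted_list_of_set (occupied N - \<alpha>)))"
  by (simp add: excitation_def hops_def)

lemma linear_hops: "linear (hops zs)"
proof (induction zs)
  case Nil then show ?case by (simp add: hops_Nil[abs_def] linear_id[unfolded id_def])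
next
  case (Cons z zs)
  from linear_compose[OF Cons linear_hop] show ?case by (simp add: hops_Cons[abs_def] comp_def)
qed

lemma hops_commute:
  assumes "set zs \<subseteq> (- occ) \<times> occ" "set ws \<subseteq> (- occ) \<times> occ"
  shows "hops zs (hops ws c) = hops ws (hops zs c)"
proof -
  have 1: "hop (fst z) (snd z) (hops ws c) = hops ws (hop (fst z) (snd z) c)"
    if "z \<in> (- occ) \<times> occ" "set ws \<subseteq> (- occ) \<times> occ" for z c and ws :: "('a \<times> 'a) list"
    using that(2)
  proof (induction ws)
    case (Cons w ws)
    then have "w \<in> (- occ) \<times> occ" by simp
    with that(1) have "fst z \<noteq> snd w" "fst w \<noteq> snd z" by (auto simp: mem_Times_iff)
    from hop_commute[OF this] show ?case using Cons by (simp add: hops_Cons)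
  qed (simp add: hops_Nil)
  show ?thesis using assms(1)
  proof (induction zs)
    case (Cons z zs)
    then show ?case using 1[of z ws, OF _ assms(2)] by (simp add: hops_Cons)
  qed (simp add: hops_Nil)
qed

lemma zip_excitation:
  "set (zip (sorted_list_of_set (\<alpha> - occupied N)) (sorted_list_of_set (occupied N - \<alpha>))) \<subseteq> (- occupied N) \<times> occupied N"
  by (auto dest: set_zip_leftD set_zip_rightD)

lemma excitation_commute: "excitation N \<alpha> (excitation N \<beta> c) = excitation N \<beta> (excitation N \<alpha> c)"
  unfolding excitation_eq_hops by (rule hops_commute[OF zip_excitation zip_excitation])

lemma linear_excitation: "linear (excitation N \<alpha>)"
  unfolding excitation_eq_hops by (rule linear_hops)

definition excited_level :: "nat \<Rightarrow> nat \<Rightarrow> 'k::{finite,linorder} fock set" where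
  "excited_level N j = {c. \<forall>S. c $ S \<noteq> 0 \<longrightarrow> j \<le> card (S - occupied N)}"

lemma hops_level:
  assumes "set zs \<subseteq> (- occupied N) \<times> occupied N" "c \<in> excited_level N j"
  shows "hops zs c \<in> excited_level N (length zs + j)"
  using assms(1)
proof (induction zs)
  case (Cons z zs)
  have z: "fst z \<notin> occupied N" "snd z \<in> occupied N" using Cons.prems by (auto simp: mem_Times_iff)
  then have ne: "fst z \<noteq> snd z" by auto
  have "length (z # zs) + j \<le> card (S - occupied N)" if "hops (z # zs) c $ S \<noteq> 0" for S
  proof -
    let ?S = "insert (snd z) (S - {fst z})"
    note h = hop_nth_nonzero[OF that[unfolded hops_Cons] ne]
    have "length zs + j \<le> card (?S - occupied N)" using Cons h(3) by (auto simp: excited_level_def)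
    also have "?S - occupied N = (S - occupied N) - {fst z}" using z by auto
    also have "card \<dots> = card (S - occupied N) - 1" using z h(1) by simp
    finally show ?thesis using z h(1) card_gt_0_iff[of "S - occupied N"] by auto
  qed
  then show ?case by (auto simp: excited_level_def)
qed (simp add: hops_Nil assms)

lemma hops_sector:
  assumes "set zs \<subseteq> (- occ) \<times> occ" "c \<in> sector N"
  shows "hops zs c \<in> sector N"
  using assms(1)
proof (induction zs)
  case (Cons z zs)
  have ne: "fst z \<noteq> snd z" using Cons.prems by (auto simp: mem_Times_iff)
  have "card S = N" if "hops (z # zs) c $ S \<noteq> 0" for S
  proof -
    note h = hop_nth_nonzero[OF that[unfolded hops_Cons] ne]
    have "card (insert (snd z) (S - {fst z})) = N" using Cons h(3) by (auto simp: sector_def)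
    moreover have "card (insert (snd z) (S - {fst z})) = card S"
      using h(1,2) card_Suc_Diff1[of S "fst z"] by simp
    ultimately show ?thesis by simp
  qed
  then show ?case by (auto simp: sector_def)
qed (simp add: hops_Nil assms)

lemma excitation_sector: "c \<in> sector M \<Longrightarrow> excitation N \<alpha> c \<in> sector M"
  unfolding excitation_eq_hops by (rule hops_sector[OF zip_excitation])

lemma card_occupied:
  assumes "N \<le> CARD('k::{finite,linorder})"
  shows "card (occupied N :: 'k set) = N"
proof -
  have inj: "inj (\<lambda>j::'k. card {l. l < j})" and bij: "(\<lambda>j::'k. card {l. l < j}) ` UNIV = {..<CARD('k)}"
    using bij_betw_rank[where 'n = 'k] by (auto simp: bij_betw_def)
  have "(\<lambda>j::'k. card {l. l < j}) ` occupied N = {..<N}"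
  proof (intro equalityI subsetI)
    fix i assume "i \<in> {..<N}"
    then have "i \<in> range (\<lambda>j::'k. card {l. l < j})" using bij assms by auto
    then show "i \<in> (\<lambda>j::'k. card {l. l < j}) ` occupied N" using \<open>i \<in> {..<N}\<close> by (auto simp: occupied_def)
  qed (auto simp: occupied_def)
  then show ?thesis using card_image[OF inj_on_subset[OF inj], of "occupied N"] by simp
qed

lemma card_excitation_indices:
  fixes \<alpha> :: "'k::{finite,linorder} set"
  assumes N: "N \<le> CARD('k)" and \<alpha>: "\<alpha> \<in> excited N"
  shows "card (\<alpha> - occupied N) = card (occupied N - \<alpha>)" "card (\<alpha> - occupied N) > 0"
proof -
  have c: "card \<alpha> = card (occupied N :: 'k set)" using \<alpha> card_occupied[OF N] by (simp add: excited_def)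
  have "card \<alpha> = card (\<alpha> \<inter> occupied N) + card (\<alpha> - occupied N)"
    "card (occupied N :: 'k set) = card (occupied N \<inter> \<alpha>) + card (occupied N - \<alpha>)"
    by (rule card_Int_Diff, simp)+
  with c show "card (\<alpha> - occupied N) = card (occupied N - \<alpha>)" by (simp add: Int_commute)
  show "card (\<alpha> - occupied N) > 0"
  proof (rule ccontr)
    assume "\<not> card (\<alpha> - occupied N) > 0"
    then have "\<alpha> \<subseteq> occupied N" by auto
    from card_subset_eq[OF _ this c] \<alpha> show False by (auto simp: excited_def)
  qed
qed

lemma excited_level_mono: "i \<le> j \<Longrightarrow> excited_level N j \<subseteq> excited_level N i"
  by (auto simp: excited_level_def)

lemma excitation_level:
  assumes N: "N \<le> CARD('k::{finite,linorder})" and \<alpha>: "(\<alpha> :: 'k set) \<in> excited N" and c: "c \<in> excited_level N j"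
  shows "excitation N \<alpha> c \<in> excited_level N (Suc j)"
proof -
  have "excitation N \<alpha> c \<in> excited_level N (card (\<alpha> - occupied N) + j)"
    using hops_level[OF zip_excitation c, of \<alpha>] card_excitation_indices[OF N \<alpha>] by (simp add: excitation_eq_hops)
  then show ?thesis
    using excited_level_mono[of "Suc j" "card (\<alpha> - occupied N) + j" N] card_excitation_indices(2)[OF N \<alpha>] by auto
qed

lemma subspace_excited_level: "subspace (excited_level N j)"
  unfolding subspace_def excited_level_def
  by (auto, metis add.right_neutral add_cancel_left_left)

lemma subspace_sector: "subspace (sector N)"
  by (auto simp: subspace_def sector_def)

lemma cluster_level:
  assumes N: "N \<le> CARD('k::{finite,linorder})" and c: "(c :: 'k fock) \<in> excited_level N j"
  shows "cluster N t c \<in> excited_level N (Suc j)"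
  unfolding cluster_def
  by (intro subspace_sum subspace_excited_level subspace_scale excitation_level N c)

lemma cluster_sector: "c \<in> sector M \<Longrightarrow> cluster N t c \<in> sector M"
  unfolding cluster_def
  by (intro subspace_sum subspace_sector subspace_scale excitation_sector)

lemma cluster_power_level:
  assumes N: "N \<le> CARD('k::{finite,linorder})"
  shows "(cluster N t ^^ k) (c :: 'k fock) \<in> excited_level N k"
proof (induction k)
  case 0 show ?case by (simp add: excited_level_def)
qed (simp add: cluster_level[OF N])

lemma cluster_power_eq_0:
  assumes N: "N \<le> CARD('k::{finite,linorder})" and k: "k > CARD('k)"
  shows "(cluster N t ^^ k) (c :: 'k fock) = 0"
proof -
  have "(cluster N t ^^ k) c $ S = 0" for S
  proof (rule ccontr)
    assume "(cluster N t ^^ k) c $ S \<noteq> 0"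
    then have "k \<le> card (S - occupied N)" using cluster_power_level[OF N, where t = t and k = k and c = c] by (auto simp: excited_level_def)
    also have "\<dots> \<le> CARD('k)" by (rule card_mono) auto
    finally show False using k by simp
  qed
  then show ?thesis by (simp add: vec_eq_iff)
qed

lemma linear_cluster: "linear (cluster N t)"
  unfolding cluster_def[abs_def]
  by (intro linear_compose_sum ballI linear_compose_scale_right linear_excitation)

lemma linear_cluster_left: "linear (\<lambda>t. cluster N t c)"
  by (rule linearI) (simp_all add: cluster_def sum.distrib scaleR_sum_right scaleR_left_distrib)

lemma bounded_bilinear_cluster: "bounded_bilinear (cluster N)"
  by (simp add: bilinear_conv_bounded_bilinear[symmetric] bilinear_def linear_cluster linear_cluster_left)

lemma cluster_commute: "cluster N s (cluster N t c) = cluster N t (cluster N s c)"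
proof -
  have e: "excitation N \<alpha> (\<Sum>\<beta>\<in>excited N. t $ \<beta> *\<^sub>R excitation N \<beta> c) =
     (\<Sum>\<beta>\<in>excited N. t $ \<beta> *\<^sub>R excitation N \<alpha> (excitation N \<beta> c))" for \<alpha> and t :: "real^('a set)"
    by (simp add: linear_sum[OF linear_excitation] linear_cmul[OF linear_excitation])
  have "cluster N s (cluster N t c) = (\<Sum>\<alpha>\<in>excited N. \<Sum>\<beta>\<in>excited N. (s $ \<alpha> * t $ \<beta>) *\<^sub>R excitation N \<alpha> (excitation N \<beta> c))"
    by (simp add: cluster_def e scaleR_sum_right)
  also have "\<dots> = (\<Sum>\<beta>\<in>excited N. \<Sum>\<alpha>\<in>excited N. (t $ \<beta> * s $ \<alpha>) *\<^sub>R excitation N \<beta> (excitation N \<alpha> c))"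
    by (subst sum.swap) (simp add: excitation_commute mult.commute)
  also have "\<dots> = cluster N t (cluster N s c)"
    by (simp add: cluster_def e scaleR_sum_right)
  finally show ?thesis .
qed

lemma linear_funpow: "linear f \<Longrightarrow> linear (f ^^ k)" for f :: "'a::real_vector \<Rightarrow> 'a"
proof (induction k)
  case 0 then show ?case using linear_id[where 'a = 'a] by (simp add: id_def)
next
  case (Suc k) then show ?case using linear_compose[of "f ^^ k" f] by (simp add: comp_def)
qed

lemma commuting_binomial:
  fixes A B :: "'a::real_vector \<Rightarrow> 'a"
  assumes A: "linear A" and B: "linear B" and AB: "\<And>c. A (B c) = B (A c)"
  shows "((\<lambda>c. A c + B c) ^^ k) c = (\<Sum>i\<le>k. real (k choose i) *\<^sub>R (A ^^ i) ((B ^^ (k - i)) c))"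
proof (induction k)
  case (Suc k)
  have BA: "B ((A ^^ i) c) = (A ^^ i) (B c)" for i c
    by (induction i) (simp_all add: AB[symmetric])
  define g where "g i j = (A ^^ i) ((B ^^ j) c)" for i j
  have "((\<lambda>c. A c + B c) ^^ Suc k) c
     = (\<Sum>i\<le>k. real (k choose i) *\<^sub>R g (Suc i) (k - i)) + (\<Sum>i\<le>k. real (k choose i) *\<^sub>R g i (Suc k - i))"
    by (simp add: Suc linear_sum[OF A] linear_sum[OF B] linear_cmul[OF A] linear_cmul[OF B] g_def BA Suc_diff_le)
  also have "(\<Sum>i\<le>k. real (k choose i) *\<^sub>R g i (Suc k - i)) = (\<Sum>i\<le>Suc k. real (k choose i) *\<^sub>R g i (Suc k - i))"
    by simp
  also have "\<dots> = g 0 (Suc k) + (\<Sum>i\<le>k. real (k choose Suc i) *\<^sub>R g (Suc i) (k - i))"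
    by (subst sum.atMost_Suc_shift) simp
  also have "(\<Sum>i\<le>k. real (k choose i) *\<^sub>R g (Suc i) (k - i)) + (g 0 (Suc k) + (\<Sum>i\<le>k. real (k choose Suc i) *\<^sub>R g (Suc i) (k - i)))
     = g 0 (Suc k) + (\<Sum>i\<le>k. real (Suc k choose Suc i) *\<^sub>R g (Suc i) (k - i))"
    by (simp add: sum.distrib[symmetric] scaleR_left_distrib add_ac)
  also have "\<dots> = (\<Sum>i\<le>Suc k. real (Suc k choose i) *\<^sub>R g i (Suc k - i))"
    by (subst sum.atMost_Suc_shift) simp
  finally show ?case by (simp add: g_def)
qed simp

definition cluster_exp :: "nat \<Rightarrow> real^('k::{finite,linorder} set) \<Rightarrow> 'k fock \<Rightarrow> 'k fock" where
  "cluster_exp N t c = (\<Sum>k\<le>CARD('k). (cluster N t ^^ k) c /\<^sub>R fact k)"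

lemma cluster_exp_eq_sum:
  fixes c :: "'k::{finite,linorder} fock"
  assumes N: "N \<le> CARD('k)" and m: "CARD('k) < m"
  shows "cluster_exp N t c = (\<Sum>k<m. (cluster N t ^^ k) c /\<^sub>R fact k)"
  unfolding cluster_exp_def using m
  by (intro sum.mono_neutral_left) (auto simp: cluster_power_eq_0[OF N])

lemma exp_op_cluster:
  fixes c :: "'k::{finite,linorder} fock"
  assumes N: "N \<le> CARD('k)"
  shows "exp_op (cluster N t) c = cluster_exp N t c"
  unfolding exp_op_def cluster_exp_def
  by (rule suminf_finite) (auto simp: cluster_power_eq_0[OF N])

lemma exp_op_minus_cluster:
  fixes c :: "'k::{finite,linorder} fock"
  assumes N: "N \<le> CARD('k)"
  shows "exp_op (\<lambda>c. - cluster N t c) c = cluster_exp N (- t) c"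
proof -
  have "(\<lambda>c. - cluster N t c) = cluster N (- t)"
    by (simp add: fun_eq_iff linear_neg[OF linear_cluster_left])
  then show ?thesis by (simp add: exp_op_cluster[OF N])
qed

lemma linear_cluster_exp: "linear (cluster_exp N t)"
  unfolding cluster_exp_def[abs_def]
  by (intro linear_compose_sum ballI linear_compose_scale_right linear_funpow linear_cluster)

lemma cluster_exp_0: "cluster_exp N 0 c = c"
proof -
  have z: "cluster N 0 c = 0" for c :: "'a fock" by (simp add: cluster_def)
  have "(cluster N 0 ^^ k) c = (if k = 0 then c else 0)" for k
    by (induction k) (simp_all add: z)
  then show ?thesis by (simp add: cluster_exp_def if_distrib[where f = "\<lambda>x. x /\<^sub>R _"] cong: if_cong)
qed

lemma cluster_exp_add:
  fixes c :: "'k::{finite,linorder} fock"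
  assumes N: "N \<le> CARD('k)"
  shows "cluster_exp N (s + t) c = cluster_exp N s (cluster_exp N t c)"
proof -
  let ?M = "Suc CARD('k)"
  define h where "h i j = (1 / (fact i * fact j)) *\<^sub>R (cluster N s ^^ i) ((cluster N t ^^ j) c)" for i j
  have add: "cluster N (s + t) = (\<lambda>c. cluster N s c + cluster N t c)"
    by (simp add: fun_eq_iff linear_add[OF linear_cluster_left])
  have h0: "h i j = 0" if "i \<ge> ?M \<or> j \<ge> ?M" for i j
    using that cluster_power_eq_0[OF N, of i s] cluster_power_eq_0[OF N, of j t]
    by (auto simp: h_def Suc_le_eq linear_0[OF linear_funpow[OF linear_cluster]])
  have "cluster_exp N (s + t) c = (\<Sum>k<2 * ?M. (cluster N (s + t) ^^ k) c /\<^sub>R fact k)"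
    by (rule cluster_exp_eq_sum[OF N]) simp
  also have "\<dots> = (\<Sum>k<2 * ?M. \<Sum>i\<le>k. h i (k - i))"
  proof (intro sum.cong refl)
    fix k
    have "(cluster N (s + t) ^^ k) c /\<^sub>R fact k
       = (\<Sum>i\<le>k. (real (k choose i) / fact k) *\<^sub>R (cluster N s ^^ i) ((cluster N t ^^ (k - i)) c))"
      unfolding add
      by (subst commuting_binomial) (auto simp: linear_cluster cluster_commute scaleR_sum_right divide_inverse mult.commute)
    also have "\<dots> = (\<Sum>i\<le>k. h i (k - i))"
      by (intro sum.cong refl) (simp add: h_def binomial_fact field_simps)
    finally show "(cluster N (s + t) ^^ k) c /\<^sub>R fact k = (\<Sum>i\<le>k. h i (k - i))" .
  qed
  also have "\<dots> = (\<Sum>(i,j)\<in>{(i,j). i + j < 2 * ?M}. h i j)"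
    by (rule sum.triangle_reindex[symmetric])
  also have "\<dots> = (\<Sum>(i,j)\<in>{..<?M} \<times> {..<?M}. h i j)"
  proof (rule sum.mono_neutral_right)
    show "finite {(i, j). i + j < 2 * ?M}"
      by (rule finite_subset[of _ "{..<2 * ?M} \<times> {..<2 * ?M}"]) auto
    show "\<forall>z\<in>{(i, j). i + j < 2 * ?M} - {..<?M} \<times> {..<?M}. (case z of (i, j) \<Rightarrow> h i j) = 0"
    proof
      fix z assume z: "z \<in> {(i, j). i + j < 2 * ?M} - {..<?M} \<times> {..<?M}"
      obtain i j where ij: "z = (i, j)" by fastforce
      with z have "i \<ge> ?M \<or> j \<ge> ?M" by auto
      with h0[of i j] show "(case z of (i, j) \<Rightarrow> h i j) = 0" by (simp add: ij)
    qed
  qed auto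
  also have "\<dots> = (\<Sum>i<?M. \<Sum>j<?M. h i j)"
    by (rule sum.cartesian_product[symmetric])
  also have "\<dots> = cluster_exp N s (cluster_exp N t c)"
    unfolding cluster_exp_eq_sum[OF N lessI] linear_sum[OF linear_funpow[OF linear_cluster]]
      linear_cmul[OF linear_funpow[OF linear_cluster]] scaleR_sum_right
    by (simp add: h_def divide_inverse mult.commute)
  finally show ?thesis .
qed

lemma cluster_exp_inverse:
  fixes c :: "'k::{finite,linorder} fock"
  assumes N: "N \<le> CARD('k)"
  shows "cluster_exp N (- t) (cluster_exp N t c) = c" "cluster_exp N t (cluster_exp N (- t) c) = c"
  using cluster_exp_add[OF N, of "- t" t c] cluster_exp_add[OF N, of t "- t" c] by (simp_all add: cluster_exp_0)

lemma cluster_exp_sector: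
  assumes "c \<in> sector M"
  shows "cluster_exp N t c \<in> sector M"
proof -
  have "(cluster N t ^^ k) c \<in> sector M" for k
    by (induction k) (simp_all add: assms cluster_sector)
  then show ?thesis
    unfolding cluster_exp_def by (intro subspace_sum subspace_scale subspace_sector)
qed

lemma cluster_exp_nth_occupied:
  fixes t :: "real^('k::{finite,linorder} set)"
  assumes N: "N \<le> CARD('k)"
  shows "cluster_exp N t c $ occupied N = c $ occupied N"
proof -
  have z: "(cluster N t ^^ k) c $ occupied N = 0" if "k > 0" for k
    using cluster_power_level[OF N, where t = t and k = k and c = c] that by (auto simp: excited_level_def)
  have "cluster_exp N t c $ occupied N = (\<Sum>k\<le>CARD('k). if k = 0 then c $ occupied N else 0)"
    unfolding cluster_exp_def sum_component vector_scaleR_component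
    by (rule sum.cong) (simp_all add: z)
  then show ?thesis by simp
qed

lemma has_derivative_cluster_exp:
  fixes c :: "real^('k::{finite,linorder} set) \<Rightarrow> 'k fock"
  assumes c: "(c has_derivative c') (at 0)"
  shows "((\<lambda>s. cluster_exp N (a *\<^sub>R s) (c s)) has_derivative (\<lambda>h. c' h + a *\<^sub>R cluster N h (c 0))) (at 0)"
proof -
  have z: "cluster N 0 x = 0" for x :: "'k fock" by (simp add: cluster_def)
  have d: "((\<lambda>s. (cluster N (a *\<^sub>R s) ^^ k) (c s)) has_derivative
      (\<lambda>h. if k = 0 then c' h else if k = 1 then a *\<^sub>R cluster N h (c 0) else 0)) (at 0)" for k
  proof (induction k)
    case 0 show ?case using c by simp
  next
    case (Suc k)
    have k0: "(cluster N 0 ^^ k) x = (if k = 0 then x else 0)" for x :: "'k fock" by (cases k) (simp_all add: z)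
    have "((\<lambda>s. a *\<^sub>R s) has_derivative (\<lambda>h. a *\<^sub>R h)) (at (0 :: real^('k set)))"
      by (auto intro!: derivative_eq_intros)
    from bounded_bilinear.FDERIV[OF bounded_bilinear_cluster this Suc, of N]
    have "((\<lambda>s. (cluster N (a *\<^sub>R s) ^^ Suc k) (c s)) has_derivative
        (\<lambda>h. cluster N (a *\<^sub>R 0) (if k = 0 then c' h else if k = 1 then a *\<^sub>R cluster N h (c 0) else 0)
          + cluster N (a *\<^sub>R h) ((cluster N (a *\<^sub>R 0) ^^ k) (c 0)))) (at 0)"
      by simp
    moreover have "(\<lambda>h. cluster N (a *\<^sub>R 0) (if k = 0 then c' h else if k = 1 then a *\<^sub>R cluster N h (c 0) else 0)
          + cluster N (a *\<^sub>R h) ((cluster N (a *\<^sub>R 0) ^^ k) (c 0)))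
       = (\<lambda>h. if Suc k = 0 then c' h else if Suc k = 1 then a *\<^sub>R cluster N h (c 0) else 0)"
      by (simp add: fun_eq_iff z k0 linear_cmul[OF linear_cluster_left] linear_0[OF linear_cluster])
    ultimately show ?case by simp
  qed
  have "((\<lambda>s. \<Sum>k\<le>CARD('k). (cluster N (a *\<^sub>R s) ^^ k) (c s) /\<^sub>R fact k) has_derivative
    (\<lambda>h. \<Sum>k\<le>CARD('k). (if k = 0 then c' h else if k = 1 then a *\<^sub>R cluster N h (c 0) else 0) /\<^sub>R fact k)) (at 0)"
    by (intro has_derivative_sum has_derivative_scaleR_right d)
  moreover have "(\<Sum>k\<le>CARD('k). (if k = 0 then c' h else if k = 1 then a *\<^sub>R cluster N h (c 0) else 0) /\<^sub>R fact k)
     = c' h + a *\<^sub>R cluster N h (c 0)" for h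
  proof -
    have "(\<Sum>k\<le>CARD('k). (if k = 0 then c' h else if k = 1 then a *\<^sub>R cluster N h (c 0) else 0) /\<^sub>R fact k)
      = (\<Sum>k\<in>{0,1}. (if k = 0 then c' h else if k = 1 then a *\<^sub>R cluster N h (c 0) else 0) /\<^sub>R fact k)"
      by (rule sum.mono_neutral_right) (auto simp: Suc_le_eq)
    then show ?thesis by simp
  qed
  ultimately show ?thesis by (simp add: cluster_exp_def)
qed

lemma continuous_on_cluster_exp:
  fixes f :: "'a::topological_space \<Rightarrow> real^('k::{finite,linorder} set)"
  assumes f: "continuous_on S f" and g: "continuous_on S g"
  shows "continuous_on S (\<lambda>x. cluster_exp N (f x) (g x))"
proof -
  have "continuous_on S (\<lambda>x. (cluster N (f x) ^^ k) (g x))" for k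
  proof (induction k)
    case (Suc k)
    from bounded_bilinear.continuous_on[OF bounded_bilinear_cluster f Suc] show ?case by simp
  qed (simp add: g)
  then show ?thesis unfolding cluster_exp_def by (intro continuous_intros)
qed

lemma hops_zip_reference:
  assumes "length As = length Is" "distinct As" "distinct Is" "set As \<inter> occ = {}" "set Is \<subseteq> occ"
  shows "\<exists>e. e * e = 1 \<and> hops (zip As Is) (axis occ 1) = e *\<^sub>R axis ((occ - set Is) \<union> set As) 1"
  using assms
proof (induction As Is rule: list_induct2)
  case Nil show ?case by (intro exI[of _ 1]) (simp add: hops_Nil)
next
  case (Cons A As I Is)
  let ?S = "(occ - set Is) \<union> set As"
  from Cons obtain e where e: "e * e = 1" "hops (zip As Is) (axis occ 1) = e *\<^sub>R axis ?S 1" by auto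
  have S: "I \<in> ?S" "A \<notin> ?S" using Cons.prems by auto
  have S': "insert A (?S - {I}) = (occ - set (I # Is)) \<union> set (A # As)" using Cons.prems by auto
  have sq: "(a * b) * (a * b) = 1" if "a * a = 1" "b * b = 1" for a b :: real
  proof -
    have "(a * b) * (a * b) = (a * a) * (b * b)" by (simp only: mult_ac)
    with that show ?thesis by simp
  qed
  define e' where "e' = jordan_wigner I (?S - {I}) * jordan_wigner A (insert A (?S - {I}))"
  have "(e * e') * (e * e') = 1"
    unfolding e'_def by (intro sq e(1) jordan_wigner_square)
  moreover have "hops (zip (A # As) (I # Is)) (axis occ 1) = (e * e') *\<^sub>R axis (insert A (?S - {I})) 1"
    by (simp add: hops_Cons e(2) linear_cmul[OF linear_hop] hop_axis[OF S] e'_def)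
  ultimately show ?case unfolding S' by blast
qed

definition excitation_sign :: "nat \<Rightarrow> 'k::{finite,linorder} set \<Rightarrow> real" where
  "excitation_sign N \<alpha> = excitation N \<alpha> (reference N) $ \<alpha>"

lemma
  fixes \<alpha> :: "'k::{finite,linorder} set"
  assumes N: "N \<le> CARD('k)" and \<alpha>: "\<alpha> \<in> excited N"
  shows excitation_reference: "excitation N \<alpha> (reference N) = excitation_sign N \<alpha> *\<^sub>R axis \<alpha> 1"
    and excitation_sign_square: "excitation_sign N \<alpha> * excitation_sign N \<alpha> = 1"
proof -
  have "(occupied N - (occupied N - \<alpha>)) \<union> (\<alpha> - occupied N) = \<alpha>" by auto
  then have "\<exists>e. e * e = 1 \<and> excitation N \<alpha> (reference N) = e *\<^sub>R axis \<alpha> 1"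
    using hops_zip_reference[of "sorted_list_of_set (\<alpha> - occupied N)" "sorted_list_of_set (occupied N - \<alpha>)" "occupied N"]
      card_excitation_indices(1)[OF N \<alpha>] by (simp add: excitation_eq_hops reference_def Diff_Int_distrib2)
  then obtain e where e: "e * e = 1" "excitation N \<alpha> (reference N) = e *\<^sub>R axis \<alpha> 1" by blast
  then have "excitation_sign N \<alpha> = e" by (simp add: excitation_sign_def)
  with e show "excitation N \<alpha> (reference N) = excitation_sign N \<alpha> *\<^sub>R axis \<alpha> 1"
    "excitation_sign N \<alpha> * excitation_sign N \<alpha> = 1" by simp_all
qed

lemma cluster_reference_nth:
  fixes t :: "real^('k::{finite,linorder} set)"
  assumes N: "N \<le> CARD('k)"
  shows "cluster N t (reference N) $ \<alpha> = (if \<alpha> \<in> excited N then excitation_sign N \<alpha> * t $ \<alpha> else 0)"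
proof -
  have "cluster N t (reference N) $ \<alpha> = (\<Sum>\<beta>\<in>excited N. t $ \<beta> * (excitation_sign N \<beta> * (if \<alpha> = \<beta> then 1 else 0)))"
    by (auto simp: cluster_def excitation_reference[OF N] axis_def intro!: sum.cong)
  then show ?thesis by (simp add: if_distrib[where f = "\<lambda>x. _ * x"] mult.commute cong: if_cong)
qed

section \<open>Brouwer degree of homogeneous maps\<close>

definition normalized :: "nat \<Rightarrow> (nat \<Rightarrow> real) \<Rightarrow> nat \<Rightarrow> real" where
  "normalized m y = (\<lambda>i. if i < m then y i / sqrt (\<Sum>j<m. (y j)\<^sup>2) else 0)"

lemma topspace_nsphere: "topspace (nsphere p) = {x. (\<Sum>i\<le>p. (x i)\<^sup>2) = 1 \<and> (\<forall>i>p. x i = 0)}"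
  by (simp add: nsphere)

lemma sum_squares_pos:
  assumes "\<exists>i\<le>p. y i \<noteq> (0::real)"
  shows "(\<Sum>j<Suc p. (y j)\<^sup>2) > 0"
proof -
  from assms obtain i where "i \<le> p" "y i \<noteq> 0" by auto
  then show ?thesis by (intro sum_pos2[of _ i]) auto
qed

lemma normalized_in_nsphere:
  assumes "\<exists>i\<le>p. y i \<noteq> 0"
  shows "normalized (Suc p) y \<in> topspace (nsphere p)"
proof -
  let ?S = "\<Sum>j<Suc p. (y j)\<^sup>2"
  have "(\<Sum>i\<le>p. (normalized (Suc p) y i)\<^sup>2) = (\<Sum>i<Suc p. (y i)\<^sup>2 / ?S)"
    using sum_squares_pos[OF assms]
    by (intro sum.cong) (auto simp: normalized_def power_divide)
  also have "\<dots> = 1"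
    using sum_squares_pos[OF assms] by (simp only: sum_divide_distrib[symmetric]) simp
  finally show ?thesis by (auto simp: topspace_nsphere normalized_def)
qed

lemma continuous_map_normalized:
  assumes f: "\<And>i. i \<le> p \<Longrightarrow> continuous_map X euclideanreal (\<lambda>x. f x i)"
    and nz: "\<And>x. x \<in> topspace X \<Longrightarrow> \<exists>i\<le>p. f x i \<noteq> 0"
  shows "continuous_map X (nsphere p) (\<lambda>x. normalized (Suc p) (f x))"
proof -
  have "continuous_map X euclideanreal (\<lambda>x. normalized (Suc p) (f x) i)" for i
  proof (cases "i < Suc p")
    case True
    have "continuous_map X euclideanreal (\<lambda>x. f x i / sqrt (\<Sum>j<Suc p. (f x j)\<^sup>2))"
    proof (intro continuous_map_real_divide continuous_map_sqrt continuous_map_sum continuous_map_real_pow f)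
      show "sqrt (\<Sum>j<Suc p. (f x j)\<^sup>2) \<noteq> 0" if "x \<in> topspace X" for x
        using sum_squares_pos[OF nz[OF that]] by (simp del: sum.lessThan_Suc)
    qed (use True in auto)
    with True show ?thesis by (simp add: normalized_def)
  qed (simp add: normalized_def)
  then show ?thesis
    using normalized_in_nsphere[OF nz] unfolding topspace_nsphere
    unfolding nsphere continuous_map_in_subtopology continuous_map_componentwise_UNIV by auto
qed

lemma Brouwer_degree2_normalized_homotopic:
  assumes f: "\<And>i. i \<le> p \<Longrightarrow> continuous_map (nsphere p) euclideanreal (\<lambda>x. f x i)"
    and g: "\<And>i. i \<le> p \<Longrightarrow> continuous_map (nsphere p) euclideanreal (\<lambda>x. g x i)"
    and nz: "\<And>x s. x \<in> topspace (nsphere p) \<Longrightarrow> 0 \<le> s \<Longrightarrow> s \<le> 1 \<Longrightarrow> \<exists>i\<le>p. (1 - s) * f x i + s * g x i \<noteq> 0"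
  shows "Brouwer_degree2 p (\<lambda>x. normalized (Suc p) (f x)) = Brouwer_degree2 p (\<lambda>x. normalized (Suc p) (g x))"
proof (rule Brouwer_degree2_homotopic)
  let ?X = "prod_topology (top_of_set {0..1::real}) (nsphere p)"
  have fst: "continuous_map ?X euclideanreal fst"
    using continuous_map_fst continuous_map_into_fulltopology by blast
  have "continuous_map ?X (nsphere p) (\<lambda>z. normalized (Suc p) (\<lambda>i. (1 - fst z) * f (snd z) i + fst z * g (snd z) i))"
  proof (rule continuous_map_normalized)
    fix i assume i: "i \<le> p"
    have "continuous_map ?X euclideanreal (\<lambda>z. f (snd z) i)" "continuous_map ?X euclideanreal (\<lambda>z. g (snd z) i)"
      using continuous_map_compose[OF continuous_map_snd f[OF i], of "top_of_set {0..1::real}"]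
        continuous_map_compose[OF continuous_map_snd g[OF i], of "top_of_set {0..1::real}"]
      by (simp_all add: comp_def)
    then show "continuous_map ?X euclideanreal (\<lambda>z. (1 - fst z) * f (snd z) i + fst z * g (snd z) i)"
      using fst by (intro continuous_map_add continuous_map_real_mult continuous_map_diff) auto
  qed (use nz in auto)
  then show "homotopic_with (\<lambda>x. True) (nsphere p) (nsphere p) (\<lambda>x. normalized (Suc p) (f x)) (\<lambda>x. normalized (Suc p) (g x))"
    unfolding homotopic_with_def by (intro exI conjI) auto
qed

lemma normalized_scale:
  assumes "c > 0"
  shows "normalized m (\<lambda>i. c * y i) = normalized m y"
proof -
  have "(\<Sum>j<m. (c * y j)\<^sup>2) = c\<^sup>2 * (\<Sum>j<m. (y j)\<^sup>2)"
    by (simp add: power_mult_distrib sum_distrib_left)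
  then show ?thesis using assms by (auto simp: normalized_def fun_eq_iff real_sqrt_mult)
qed

lemma normalized_nsphere: "y \<in> topspace (nsphere p) \<Longrightarrow> normalized (Suc p) y = y"
  by (auto simp: topspace_nsphere normalized_def fun_eq_iff lessThan_Suc_atMost)

definition sphere_map :: "nat \<Rightarrow> ((nat \<Rightarrow> real) \<Rightarrow> nat \<Rightarrow> real) \<Rightarrow> bool" where
  "sphere_map p F \<longleftrightarrow>
     (\<forall>c x. F (\<lambda>i. c * x i) = (\<lambda>i. c * F x i)) \<and> (\<forall>x. \<forall>i>p. F x i = 0) \<and>
     (\<forall>x \<in> topspace (nsphere p). F x \<noteq> (\<lambda>_. 0)) \<and>
     (\<forall>i. continuous_map (nsphere p) euclideanreal (\<lambda>x. F x i))"

definition sphere_degree :: "nat \<Rightarrow> ((nat \<Rightarrow> real) \<Rightarrow> nat \<Rightarrow> real) \<Rightarrow> int" where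
  "sphere_degree p F = Brouwer_degree2 p (\<lambda>x. normalized (Suc p) (F x))"

lemma sphere_map_nonzero:
  assumes "sphere_map p F" "x \<in> topspace (nsphere p)"
  shows "\<exists>i\<le>p. F x i \<noteq> 0"
proof (rule ccontr)
  assume "\<not> (\<exists>i\<le>p. F x i \<noteq> 0)"
  moreover have "\<forall>i>p. F x i = 0" using assms by (auto simp: sphere_map_def)
  ultimately have "F x = (\<lambda>_. 0)" by (auto simp: fun_eq_iff not_le)
  with assms show False by (auto simp: sphere_map_def)
qed

lemma continuous_map_sphere_map:
  "sphere_map p F \<Longrightarrow> continuous_map (nsphere p) (nsphere p) (\<lambda>x. normalized (Suc p) (F x))"
  by (rule continuous_map_normalized) (auto simp: sphere_map_nonzero, simp add: sphere_map_def)

lemma sphere_degree_compose: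
  assumes F: "sphere_map p F" and G: "sphere_map p G"
  shows "sphere_degree p (\<lambda>x. G (F x)) = sphere_degree p G * sphere_degree p F"
proof -
  have "normalized (Suc p) (G (F x)) = normalized (Suc p) (G (normalized (Suc p) (F x)))"
    if x: "x \<in> topspace (nsphere p)" for x
  proof -
    define c where "c = 1 / sqrt (\<Sum>j<Suc p. (F x j)\<^sup>2)"
    have c: "c > 0" using sum_squares_pos[OF sphere_map_nonzero[OF F x]] by (simp add: c_def)
    have "normalized (Suc p) (F x) = (\<lambda>i. c * F x i)"
      using F by (auto simp: normalized_def c_def fun_eq_iff sphere_map_def)
    moreover have "G (\<lambda>i. c * F x i) = (\<lambda>i. c * G (F x) i)"
      using G by (auto simp: sphere_map_def)
    ultimately show ?thesis by (simp add: normalized_scale[OF c])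
  qed
  then have "sphere_degree p (\<lambda>x. G (F x))
    = Brouwer_degree2 p ((\<lambda>x. normalized (Suc p) (G x)) \<circ> (\<lambda>x. normalized (Suc p) (F x)))"
    unfolding sphere_degree_def by (intro Brouwer_degree2_eq) simp
  also have "\<dots> = sphere_degree p G * sphere_degree p F"
    unfolding sphere_degree_def by (intro Brouwer_degree2_compose continuous_map_sphere_map F G)
  finally show ?thesis .
qed

lemma sphere_degree_cong:
  "(\<And>x. x \<in> topspace (nsphere p) \<Longrightarrow> F x = G x) \<Longrightarrow> sphere_degree p F = sphere_degree p G"
  unfolding sphere_degree_def by (intro Brouwer_degree2_eq) simp

lemma sphere_degree_conjugate:
  assumes F: "sphere_map p F" and D: "sphere_map p D" and Q: "sphere_map p Q" and R: "sphere_map p R"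
    and RQ: "\<And>x. (\<forall>i>p. x i = 0) \<Longrightarrow> R (Q x) = x"
    and comm: "\<And>x. (\<forall>i>p. x i = 0) \<Longrightarrow> Q (F x) = D (Q x)"
  shows "sphere_degree p F = sphere_degree p D"
proof -
  have E: "\<forall>i>p. x i = 0" if "x \<in> topspace (nsphere p)" for x
    using that by (simp add: topspace_nsphere)
  have "sphere_degree p R * sphere_degree p Q = sphere_degree p (\<lambda>x. x)"
    using RQ E by (subst sphere_degree_compose[OF Q R, symmetric]) (auto intro: sphere_degree_cong)
  also have "\<dots> = Brouwer_degree2 p id"
    unfolding sphere_degree_def by (intro Brouwer_degree2_eq) (simp add: normalized_nsphere)
  finally have "sphere_degree p Q \<noteq> 0" by auto
  moreover have "sphere_degree p Q * sphere_degree p F = sphere_degree p D * sphere_degree p Q"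
    using comm E unfolding sphere_degree_compose[OF F Q, symmetric] sphere_degree_compose[OF Q D, symmetric]
    by (auto intro: sphere_degree_cong)
  ultimately show ?thesis by simp
qed

lemma continuous_map_nsphere_transpose:
  assumes "k \<le> p"
  shows "continuous_map (nsphere p) (nsphere p) (\<lambda>x i. x (Transposition.transpose 0 k i))"
proof -
  have "(\<Sum>i\<le>p. (x (Transposition.transpose 0 k i))\<^sup>2) = (\<Sum>i\<le>p. (x i)\<^sup>2)" for x :: "nat \<Rightarrow> real"
    using assms by (intro sum.permute[symmetric, unfolded comp_def] permutes_swap_id) auto
  then show ?thesis
    using assms continuous_map_nsphere_projection[of p]
    by (auto simp: nsphere continuous_map_in_subtopology continuous_map_componentwise_UNIV Transposition.transpose_def)
qed

lemma Brouwer_degree2_reflection_any: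
  assumes "k \<le> p"
  shows "Brouwer_degree2 p (\<lambda>x i. if i = k then - x i else x i) = - 1"
proof -
  let ?t = "\<lambda>(x::nat \<Rightarrow> real) i. x (Transposition.transpose 0 k i)"
  let ?r = "\<lambda>(x::nat \<Rightarrow> real) i. if i = 0 then - x i else x i"
  note t = continuous_map_nsphere_transpose[OF assms]
  note r = continuous_map_nsphere_reflection[of p 0]
  have "?t \<circ> ?t = id" by (auto simp: fun_eq_iff)
  then have tt: "Brouwer_degree2 p ?t * Brouwer_degree2 p ?t = 1"
    using Brouwer_degree2_compose[OF t t] by simp
  have "(\<lambda>x i. if i = k then - x i else x i) = ?t \<circ> (?r \<circ> ?t)"
    by (auto simp: fun_eq_iff Transposition.transpose_def)
  then have "Brouwer_degree2 p (\<lambda>x i. if i = k then - x i else x i)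
     = Brouwer_degree2 p ?t * (Brouwer_degree2 p ?r * Brouwer_degree2 p ?t)"
    using Brouwer_degree2_compose[OF continuous_map_compose[OF t r] t] Brouwer_degree2_compose[OF t r] by simp
  then show ?thesis using tt by (simp add: Brouwer_degree2_reflection)
qed

lemma Brouwer_degree2_reflections:
  assumes "S \<subseteq> {..p}"
  shows "continuous_map (nsphere p) (nsphere p) (\<lambda>x i. if i \<in> S then - x i else x i) \<and>
    Brouwer_degree2 p (\<lambda>x i. if i \<in> S then - x i else x i) = (- 1) ^ card S"
proof -
  have "finite S" using assms finite_subset by blast
  then show ?thesis using assms
  proof (induction S)
    case empty
    show ?case using Brouwer_degree2_id[of p] by (simp add: id_def)
  next
    case (insert k S)
    let ?r = "\<lambda>(x::nat \<Rightarrow> real) i. if i = k then - x i else x i"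
    let ?s = "\<lambda>(x::nat \<Rightarrow> real) i. if i \<in> S then - x i else x i"
    have eq: "(\<lambda>x i. if i \<in> insert k S then - x i else x i) = ?r \<circ> ?s"
      using insert.hyps by (auto simp: fun_eq_iff)
    have s: "continuous_map (nsphere p) (nsphere p) ?s" "Brouwer_degree2 p ?s = (- 1) ^ card S"
      using insert by auto
    note r = continuous_map_nsphere_reflection[of p k]
    show ?case
      unfolding eq using continuous_map_compose[OF s(1) r] Brouwer_degree2_compose[OF s(1) r] s(2)
        Brouwer_degree2_reflection_any[of k p] insert by simp
  qed
qed

lemma nsphere_nonzero:
  assumes "x \<in> topspace (nsphere p)"
  shows "\<exists>i\<le>p. x i \<noteq> 0"
proof (rule ccontr)
  assume "\<not> (\<exists>i\<le>p. x i \<noteq> 0)"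
  then have "(\<Sum>i\<le>p. (x i)\<^sup>2) = 0" by simp
  with assms show False by (simp add: topspace_nsphere)
qed

lemma sphere_map_linear:
  fixes f :: "nat \<Rightarrow> 'a::real_vector \<Rightarrow> real" and a :: "nat \<Rightarrow> 'a"
  assumes f: "\<And>i. i \<le> p \<Longrightarrow> linear (f i)"
    and nz: "\<And>x. x \<in> topspace (nsphere p) \<Longrightarrow> \<exists>i\<le>p. f i (\<Sum>j\<le>p. x j *\<^sub>R a j) \<noteq> 0"
  shows "sphere_map p (\<lambda>x i. if i \<le> p then f i (\<Sum>j\<le>p. x j *\<^sub>R a j) else 0)"
proof -
  have lin: "f i (\<Sum>j\<le>p. x j *\<^sub>R a j) = (\<Sum>j\<le>p. x j * f i (a j))" if "i \<le> p" for i x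
    using f[OF that] by (simp add: linear_sum linear_cmul)
  show ?thesis
    unfolding sphere_map_def
  proof (intro conjI allI ballI impI)
    show "continuous_map (nsphere p) euclideanreal (\<lambda>x. if i \<le> p then f i (\<Sum>j\<le>p. x j *\<^sub>R a j) else 0)" for i
      by (cases "i \<le> p")
        (auto simp: lin intro!: continuous_map_sum continuous_map_real_mult_right continuous_map_nsphere_projection)
    show "(\<lambda>i. if i \<le> p then f i (\<Sum>j\<le>p. x j *\<^sub>R a j) else 0) \<noteq> (\<lambda>_. 0)" if "x \<in> topspace (nsphere p)" for x
      using nz[OF that] by (auto simp: fun_eq_iff)
  qed (auto simp: fun_eq_iff lin sum_distrib_left mult.assoc)
qed

lemma sphere_map_diagonal:
  assumes "\<And>i. i \<le> p \<Longrightarrow> d i \<noteq> 0"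
  shows "sphere_map p (\<lambda>x i. if i \<le> p then d i * x i else 0)"
  unfolding sphere_map_def
proof (intro conjI allI ballI impI)
  show "continuous_map (nsphere p) euclideanreal (\<lambda>x. if i \<le> p then d i * x i else 0)" for i
    by (cases "i \<le> p") (auto intro!: continuous_map_real_mult_left continuous_map_nsphere_projection)
  show "(\<lambda>i. if i \<le> p then d i * x i else 0) \<noteq> (\<lambda>_. 0)" if "x \<in> topspace (nsphere p)" for x
    using nsphere_nonzero[OF that] assms by (auto simp: fun_eq_iff)
qed (auto simp: fun_eq_iff)

lemma sphere_degree_diagonal:
  assumes d: "\<And>i. i \<le> p \<Longrightarrow> d i \<noteq> 0"
  shows "sphere_degree p (\<lambda>x i. if i \<le> p then d i * x i else 0) = (- 1) ^ card {i. i \<le> p \<and> d i < 0}"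
proof -
  let ?S = "{i. i \<le> p \<and> d i < 0}"
  have S: "?S \<subseteq> {..p}" by auto
  have "sphere_degree p (\<lambda>x i. if i \<le> p then d i * x i else 0)
     = Brouwer_degree2 p (\<lambda>x. normalized (Suc p) (\<lambda>i. if i \<in> ?S then - x i else x i))"
    unfolding sphere_degree_def
  proof (rule Brouwer_degree2_normalized_homotopic)
    fix x :: "nat \<Rightarrow> real" and s :: real
    assume x: "x \<in> topspace (nsphere p)" and s: "0 \<le> s" "s \<le> 1"
    from nsphere_nonzero[OF x] obtain i where i: "i \<le> p" "x i \<noteq> 0" by auto
    have "(1 - s) * \<bar>d i\<bar> + s > 0"
      using s d[OF i(1)] by (cases "s = 0") (auto intro: add_nonneg_pos)
    moreover have "(1 - s) * (if i \<le> p then d i * x i else 0) + s * (if i \<in> ?S then - x i else x i)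
       = ((1 - s) * \<bar>d i\<bar> + s) * (if d i < 0 then - x i else x i)"
      using i by (auto simp: algebra_simps)
    ultimately have "(1 - s) * (if i \<le> p then d i * x i else 0) + s * (if i \<in> ?S then - x i else x i) \<noteq> 0"
      using i by auto
    with i(1) show "\<exists>i\<le>p. (1 - s) * (if i \<le> p then d i * x i else 0) + s * (if i \<in> ?S then - x i else x i) \<noteq> 0"
      by blast
  qed (use continuous_map_nsphere_projection[of p] in \<open>auto intro!: continuous_map_real_mult_left continuous_map_minus\<close>)
  also have "\<dots> = Brouwer_degree2 p (\<lambda>x i. if i \<in> ?S then - x i else x i)"
    using Brouwer_degree2_reflections[OF S]
    by (intro Brouwer_degree2_eq normalized_nsphere) (auto simp: continuous_map_def Pi_iff)
  finally show ?thesis using Brouwer_degree2_reflections[OF S] by simp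
qed

lemma zero_index_eqI:
  assumes "\<forall>\<^sub>F r in at_right 0. ball_degree m f u r = d"
  shows "zero_index m f u = d"
  unfolding zero_index_def
proof (rule the_equality)
  fix d' assume "\<forall>\<^sub>F r in at_right 0. ball_degree m f u r = d'"
  with assms have "\<forall>\<^sub>F r in at_right (0::real). d' = d" by eventually_elim simp
  then show "d' = d" by (simp add: eventually_const_iff)
qed (rule assms)

lemma zero_index_eq_sphere_degree:
  assumes F: "sphere_map p F" and \<delta>: "\<delta> > 0"
    and cont: "\<And>r i. 0 < r \<Longrightarrow> r < \<delta> \<Longrightarrow> i \<le> p \<Longrightarrow> continuous_map (nsphere p) euclideanreal (\<lambda>x. f (\<lambda>i. u i + r * x i) i)"
    and nz: "\<And>r x s. 0 < r \<Longrightarrow> r < \<delta> \<Longrightarrow> x \<in> topspace (nsphere p) \<Longrightarrow> 0 \<le> s \<Longrightarrow> s \<le> 1 \<Longrightarrow>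
        \<exists>i\<le>p. (1 - s) * f (\<lambda>i. u i + r * x i) i + s * F x i \<noteq> 0"
  shows "zero_index (Suc p) f u = sphere_degree p F"
proof (rule zero_index_eqI)
  have "ball_degree (Suc p) f u r = sphere_degree p F" if r: "0 < r" "r < \<delta>" for r
  proof -
    have "ball_degree (Suc p) f u r = Brouwer_degree2 p (\<lambda>x. normalized (Suc p) (f (\<lambda>i. u i + r * x i)))"
      by (simp add: ball_degree_def normalized_def[abs_def] Let_def)
    also have "\<dots> = sphere_degree p F"
      unfolding sphere_degree_def
      by (rule Brouwer_degree2_normalized_homotopic) (use F cont nz r in \<open>auto simp: sphere_map_def\<close>)
    finally show ?thesis .
  qed
  then show "\<forall>\<^sub>F r in at_right 0. ball_degree (Suc p) f u r = sphere_degree p F"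
    using \<delta> by (auto simp: eventually_at_right_field)
qed

section \<open>Eigenbases of symmetric operators\<close>

definition eigenbasis :: "('a::euclidean_space \<Rightarrow> 'a) \<Rightarrow> 'a set \<Rightarrow> 'a set \<Rightarrow> bool" where
  "eigenbasis H S B \<longleftrightarrow> finite B \<and> pairwise orthogonal B \<and>
     (\<forall>b\<in>B. norm b = 1 \<and> H b = (b \<bullet> H b) *\<^sub>R b) \<and> span B = S"

lemma eigenbasis_insert:
  assumes B: "eigenbasis H (S \<inter> {x. v \<bullet> x = 0}) B" and S: "subspace S"
    and v: "v \<in> S" "norm v = 1" "H v = l *\<^sub>R v"
  shows "eigenbasis H S (insert v B)" "v \<notin> B"
proof -
  have sp: "span B = S \<inter> {x. v \<bullet> x = 0}" using B by (simp add: eigenbasis_def)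
  then have BS: "B \<subseteq> S \<inter> {x. v \<bullet> x = 0}" using span_superset by blast
  have vv: "v \<bullet> v = 1" using v(2) by (simp add: dot_square_norm)
  then show "v \<notin> B" using BS by auto
  have "span (insert v B) = S"
  proof
    show "span (insert v B) \<subseteq> S" using BS v(1) S by (intro span_minimal) auto
    show "S \<subseteq> span (insert v B)"
    proof
      fix x assume x: "x \<in> S"
      have "x - (v \<bullet> x) *\<^sub>R v \<in> S" using x v S by (intro subspace_diff subspace_scale)
      then have "x - (v \<bullet> x) *\<^sub>R v \<in> span B" unfolding sp by (simp add: inner_diff_right vv)
      then show "x \<in> span (insert v B)" by (rule span_breakdown_eq[THEN iffD2, OF exI])
    qed
  qed
  moreover have "pairwise orthogonal (insert v B)"
    using B BS by (auto simp: eigenbasis_def pairwise_insert orthogonal_def inner_commute)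
  ultimately show "eigenbasis H S (insert v B)"
    using B v vv by (auto simp: eigenbasis_def)
qed

lemma nonneg_quadratic_imp_linear_coeff_0:
  fixes a q :: real
  assumes "\<And>s. 0 \<le> 2 * s * a + s\<^sup>2 * q"
  shows "a = 0"
proof (rule ccontr)
  assume a: "a \<noteq> 0"
  define c where "c = \<bar>q\<bar> + 1"
  have c: "c > 0" "q < c" by (auto simp: c_def)
  have "0 \<le> 2 * (- a / c) * a + (- a / c)\<^sup>2 * q" by (rule assms)
  also have "\<dots> = (a\<^sup>2 / c) * (q / c - 2)" using c by (simp add: power2_eq_square field_simps)
  finally have "0 \<le> (a\<^sup>2 / c) * (q / c - 2)" .
  moreover have "a\<^sup>2 / c > 0" using a c by simp
  moreover have "q / c - 2 < 0" using c by (simp add: field_simps)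
  ultimately show False using mult_pos_neg[of "a\<^sup>2 / c" "q / c - 2"] by linarith
qed

text \<open>A maximizer of the Rayleigh quotient on the unit sphere of \<open>S\<close> is an eigenvector.\<close>

lemma symmetric_eigenvector:
  fixes H :: "'a::euclidean_space \<Rightarrow> 'a"
  assumes H: "linear H" and S: "subspace S" and inv: "\<And>x. x \<in> S \<Longrightarrow> H x \<in> S"
    and sym: "\<And>x y. x \<in> S \<Longrightarrow> y \<in> S \<Longrightarrow> H x \<bullet> y = x \<bullet> H y" and ne: "S \<noteq> {0}"
  obtains v l where "v \<in> S" "norm v = 1" "H v = l *\<^sub>R v"
proof -
  let ?C = "S \<inter> sphere 0 1"
  obtain x where x: "x \<in> S" "x \<noteq> 0" using ne S subspace_0 by blast
  then have "x /\<^sub>R norm x \<in> ?C" using S by (auto intro: subspace_scale)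
  moreover have "compact ?C" by (intro closed_Int_compact closed_subspace S compact_sphere)
  moreover have "continuous_on ?C (\<lambda>x. x \<bullet> H x)"
    by (intro continuous_intros linear_continuous_on) (simp add: H linear_conv_bounded_linear[symmetric])
  ultimately obtain v where v: "v \<in> ?C" and max: "\<And>y. y \<in> ?C \<Longrightarrow> y \<bullet> H y \<le> v \<bullet> H v"
    using continuous_attains_sup[of ?C "\<lambda>x. x \<bullet> H x"] by blast
  define l where "l = v \<bullet> H v"
  have vS: "v \<in> S" and vn: "norm v = 1" using v by auto
  have vv: "v \<bullet> v = 1" using vn by (simp add: dot_square_norm)
  have q: "y \<bullet> H y \<le> l * (y \<bullet> y)" if y: "y \<in> S" for y
  proof (cases "y = 0")
    case False
    then have "y /\<^sub>R norm y \<in> ?C" using S y by (auto intro: subspace_scale)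
    from max[OF this] have "(y \<bullet> H y) / (norm y)\<^sup>2 \<le> l"
      by (simp add: l_def linear_cmul[OF H] power2_eq_square divide_inverse mult_ac)
    then show ?thesis using False by (simp add: dot_square_norm field_simps)
  qed (simp add: linear_0[OF H])
  define y where "y = l *\<^sub>R v - H v"
  have yS: "y \<in> S" unfolding y_def using vS inv S by (intro subspace_diff subspace_scale)
  have "l * (v \<bullet> y) - y \<bullet> H v = 0"
  proof (rule nonneg_quadratic_imp_linear_coeff_0)
    fix s
    have "v + s *\<^sub>R y \<in> S" using vS yS S by (intro subspace_add subspace_scale)
    from q[OF this]
    have "v \<bullet> H v + s * (v \<bullet> H y) + s * (y \<bullet> H v) + s * s * (y \<bullet> H y) \<le> l * (1 + 2 * s * (v \<bullet> y) + s * s * (y \<bullet> y))"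
      by (simp add: linear_add[OF H] linear_cmul[OF H] inner_add_left inner_add_right vv inner_commute[of y v] algebra_simps)
    moreover have "v \<bullet> H y = y \<bullet> H v" using sym[OF vS yS] by (simp add: inner_commute)
    moreover have "v \<bullet> H v = l" by (simp add: l_def)
    ultimately show "0 \<le> 2 * s * (l * (v \<bullet> y) - y \<bullet> H v) + s\<^sup>2 * (l * (y \<bullet> y) - y \<bullet> H y)"
      by (simp add: algebra_simps power2_eq_square)
  qed
  then have "y \<bullet> y = 0" by (simp add: y_def inner_diff_left inner_diff_right algebra_simps inner_commute)
  then have "H v = l *\<^sub>R v" by (simp add: y_def)
  with vS vn show ?thesis by (rule that)
qed

lemma symmetric_eigenbasis:
  fixes H :: "'a::euclidean_space \<Rightarrow> 'a"
  assumes H: "linear H" and "subspace S" "\<And>x. x \<in> S \<Longrightarrow> H x \<in> S"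
    and "\<And>x y. x \<in> S \<Longrightarrow> y \<in> S \<Longrightarrow> H x \<bullet> y = x \<bullet> H y"
  obtains B where "eigenbasis H S B"
proof -
  have "\<exists>B. eigenbasis H S B" using assms(2-)
  proof (induction "dim S" arbitrary: S rule: less_induct)
    case less
    show ?case
    proof (cases "S = {0}")
      case True
      then show ?thesis by (intro exI[of _ "{}"]) (simp add: eigenbasis_def)
    next
      case False
      from symmetric_eigenvector[OF H less.prems False] obtain v l
        where v: "v \<in> S" "norm v = 1" "H v = l *\<^sub>R v" by blast
      let ?T = "S \<inter> {x. v \<bullet> x = 0}"
      have T: "subspace ?T" by (intro subspace_inter less.prems subspace_hyperplane)
      have inv: "H x \<in> ?T" if "x \<in> ?T" for x
        using that less.prems(3)[OF v(1), of x] less.prems(2) v(3) by auto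
      have "v \<notin> ?T" using v(2) by auto
      then have "?T \<subset> S" using v(1) by blast
      then have "dim ?T < dim S"
        using T less.prems(1) by (intro dim_psubset) (simp only: span_eq_iff[THEN iffD2])
      from less.hyps[OF this T inv] less.prems(3) obtain B where "eigenbasis H ?T B" by auto
      from eigenbasis_insert(1)[OF this less.prems(1) v] show ?thesis by blast
    qed
  qed
  then show ?thesis using that by blast
qed

lemma eigenbasis_expand:
  assumes B: "eigenbasis H S B" and x: "x \<in> S"
  shows "x = (\<Sum>b\<in>B. (b \<bullet> x) *\<^sub>R b)"
proof -
  have fin: "finite B" and orth: "pairwise orthogonal B" and n: "\<And>b. b \<in> B \<Longrightarrow> norm b = 1"
    using B by (auto simp: eigenbasis_def)
  from x B have "x \<in> span B" by (simp add: eigenbasis_def)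
  then obtain u where u: "x = (\<Sum>b\<in>B. u b *\<^sub>R b)" using span_finite[OF fin] by auto
  have "b \<bullet> x = u b" if b: "b \<in> B" for b
  proof -
    have "b \<bullet> x = (\<Sum>c\<in>B. if c = b then u b else 0)"
      unfolding u inner_sum_right
      using orth b n[OF b] by (intro sum.cong) (auto simp: pairwise_def orthogonal_def dot_square_norm)
    then show ?thesis using fin b by simp
  qed
  then show ?thesis using u by simp
qed

lemma eigenbasis_card:
  assumes B: "eigenbasis H S B"
  shows "card B = dim S"
proof -
  have "independent B"
  proof (rule pairwise_orthogonal_independent)
    show "pairwise orthogonal B" using B by (simp add: eigenbasis_def)
    have "norm x = 1" if "x \<in> B" for x using B that by (simp add: eigenbasis_def)
    from this[of 0] show "0 \<notin> B" by auto
  qed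
  then have "card B = dim (span B)" by (rule real_vector.dim_span_eq_card_independent[symmetric])
  moreover have "span B = S" using B by (simp add: eigenbasis_def)
  ultimately show ?thesis by (simp only:)
qed

lemma dim_eigenspace:
  assumes B: "eigenbasis H S B" and S: "subspace S" and H: "linear H"
    and sym: "\<And>x y. x \<in> S \<Longrightarrow> y \<in> S \<Longrightarrow> H x \<bullet> y = x \<bullet> H y"
  shows "dim {x \<in> S. H x = E *\<^sub>R x} = card {b \<in> B. b \<bullet> H b = E}"
proof -
  have fin: "finite B" and orth: "pairwise orthogonal B" and n: "\<And>b. b \<in> B \<Longrightarrow> norm b = 1"
    and ev: "\<And>b. b \<in> B \<Longrightarrow> H b = (b \<bullet> H b) *\<^sub>R b" and sp: "span B = S"
    using B by (auto simp: eigenbasis_def)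
  have BS: "B \<subseteq> S" using sp span_superset by blast
  let ?C = "{b \<in> B. b \<bullet> H b = E}"
  have eq: "{x \<in> S. H x = E *\<^sub>R x} = span ?C"
  proof
    show "span ?C \<subseteq> {x \<in> S. H x = E *\<^sub>R x}"
    proof (rule span_minimal)
      show "?C \<subseteq> {x \<in> S. H x = E *\<^sub>R x}" using ev BS by auto
      show "subspace {x \<in> S. H x = E *\<^sub>R x}"
        using S by (auto simp: subspace_def linear_0[OF H] linear_add[OF H] linear_cmul[OF H] scaleR_add_right)
    qed
    show "{x \<in> S. H x = E *\<^sub>R x} \<subseteq> span ?C"
    proof clarify
      fix x assume x: "x \<in> S" "H x = E *\<^sub>R x"
      have z: "b \<bullet> x = 0" if b: "b \<in> B" "b \<bullet> H b \<noteq> E" for b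
      proof -
        have "(b \<bullet> H b) * (b \<bullet> x) = H b \<bullet> x" by (subst (2) ev[OF b(1)]) simp
        also have "\<dots> = E * (b \<bullet> x)" using sym[of b x] x BS b by auto
        finally show ?thesis using b by simp
      qed
      have "x = (\<Sum>b\<in>B. (b \<bullet> x) *\<^sub>R b)" by (rule eigenbasis_expand[OF B x(1)])
      also have "\<dots> = (\<Sum>b\<in>?C. (b \<bullet> x) *\<^sub>R b)"
        using fin z by (intro sum.mono_neutral_right) auto
      also have "\<dots> \<in> span ?C" by (intro span_sum span_scale span_base)
      finally show "x \<in> span ?C" .
    qed
  qed
  have "independent ?C"
  proof (rule pairwise_orthogonal_independent)
    show "pairwise orthogonal ?C" using orth by (auto simp: pairwise_def)
    show "0 \<notin> ?C" using n[of 0] by auto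
  qed
  then show ?thesis unfolding eq by (rule real_vector.dim_span_eq_card_independent)
qed

lemma the_sorted_list_count:
  fixes f :: "'b::linorder \<Rightarrow> nat"
  assumes "\<And>x. count M x = f x"
  shows "(THE xs. sorted xs \<and> (\<forall>x. count_list xs x = f x)) = sorted_list_of_multiset M"
proof (rule the_equality)
  show "sorted (sorted_list_of_multiset M) \<and> (\<forall>x. count_list (sorted_list_of_multiset M) x = f x)"
    by (simp add: assms sorted_sorted_list_of_multiset flip: count_mset)
next
  fix xs assume xs: "sorted xs \<and> (\<forall>x. count_list xs x = f x)"
  then have "mset xs = M" by (intro multiset_eqI) (simp add: assms count_mset)
  with xs show "xs = sorted_list_of_multiset M"
    using sorted_list_of_multiset_mset[of xs] by (simp add: sorted_sort_id)
qed

lemma sorted_nth_simple: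
  fixes xs :: "'b::linorder list"
  assumes s: "sorted xs" and nu: "nu < length xs" and c: "count_list xs (xs ! nu) = 1"
  shows "size (filter_mset (\<lambda>x. x < xs ! nu) (mset xs)) = nu"
proof -
  have c1: "card {i. i < length xs \<and> xs ! i = xs ! nu} = 1"
    using c by (simp add: count_list_eq_length_filter length_filter_conv_card eq_commute)
  then obtain j where j: "{i. i < length xs \<and> xs ! i = xs ! nu} = {j}"
    by (rule card_1_singletonE)
  have "nu \<in> {i. i < length xs \<and> xs ! i = xs ! nu}" using nu by simp
  then have "nu = j" unfolding j by simp
  moreover have "i = j" if "i < length xs" "xs ! i = xs ! nu" for i
  proof -
    from that have "i \<in> {i. i < length xs \<and> xs ! i = xs ! nu}" by simp
    then show ?thesis unfolding j by simp
  qed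
  ultimately have uniq: "i = nu" if "i < length xs" "xs ! i = xs ! nu" for i
    using that by blast
  have "{i. i < length xs \<and> xs ! i < xs ! nu} = {..<nu}"
  proof (intro equalityI subsetI)
    fix i assume "i \<in> {i. i < length xs \<and> xs ! i < xs ! nu}"
    then have "i < length xs" "\<not> xs ! nu \<le> xs ! i" by auto
    then have "\<not> nu \<le> i" using sorted_nth_mono[OF s] by blast
    then show "i \<in> {..<nu}" by simp
  next
    fix i assume "i \<in> {..<nu}"
    then have i: "i < nu" "i < length xs" using nu by auto
    then have "xs ! i \<le> xs ! nu" using sorted_nth_mono[OF s _ nu] by simp
    moreover have "xs ! i \<noteq> xs ! nu" using uniq[OF i(2)] i(1) by auto
    ultimately show "i \<in> {i. i < length xs \<and> xs ! i < xs ! nu}" using i(2) by simp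
  qed
  then have "length (filter (\<lambda>x. x < xs ! nu) xs) = nu" by (simp add: length_filter_conv_card)
  then show ?thesis by (simp flip: mset_filter)
qed

section \<open>The coupled-cluster map near a zero\<close>

lemma occupied_not_excited: "occupied N \<notin> excited N"
  by (simp add: excited_def)

lemma reference_nth: "reference N $ \<alpha> = (if \<alpha> = occupied N then 1 else 0)"
  by (simp add: reference_def axis_def)

lemma subspace_amplitudes: "subspace (amplitudes N)"
  by (auto simp: subspace_def amplitudes_def)

locale cc_operator =
  fixes N :: nat and H :: "'k::{finite,linorder} fock \<Rightarrow> 'k fock"
  assumes N_le: "N \<le> CARD('k)" and linear_H: "linear H"
    and H_sector: "H c \<in> sector N" and H_symmetric: "H c \<bullet> d = c \<bullet> H d"
begin

definition J :: "real^('k set) \<Rightarrow> 'k fock" where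
  "J s = cluster N s (reference N)"

definition cc :: "real^('k set) \<Rightarrow> real^('k set)" where
  "cc t = J (cluster_exp N (- t) (H (cluster_exp N t (reference N))))"

definition transformed :: "real^('k set) \<Rightarrow> 'k fock \<Rightarrow> 'k fock" where
  "transformed t c = cluster_exp N (- t) (H (cluster_exp N t c))"

lemma J_nth: "J s $ \<alpha> = (if \<alpha> \<in> excited N then excitation_sign N \<alpha> * s $ \<alpha> else 0)"
  by (simp add: J_def cluster_reference_nth[OF N_le])

lemma linear_J: "linear J"
  unfolding J_def[abs_def] by (rule linear_cluster_left)

lemma J_J_nth: "J (J c) $ \<alpha> = (if \<alpha> \<in> excited N then c $ \<alpha> else 0)"
proof (cases "\<alpha> \<in> excited N")
  case True
  then have "J (J c) $ \<alpha> = (excitation_sign N \<alpha> * excitation_sign N \<alpha>) * c $ \<alpha>"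
    by (simp add: J_nth mult.assoc)
  with True show ?thesis by (simp add: excitation_sign_square[OF N_le True])
qed (simp add: J_nth)

lemma J_amplitudes: "J c \<in> amplitudes N"
  by (simp add: amplitudes_def J_nth)

lemma J_J_id: "c \<in> amplitudes N \<Longrightarrow> J (J c) = c"
  by (auto simp: vec_eq_iff J_J_nth amplitudes_def)

lemma J_reference: "J (reference N) = 0"
  using occupied_not_excited[of N] by (auto simp: vec_eq_iff J_nth reference_nth)

lemma reference_sector: "reference N \<in> (sector N :: 'k fock set)"
  using card_occupied[OF N_le] by (auto simp: sector_def reference_nth)

lemma J_sector: "J s \<in> sector N"
  unfolding J_def by (rule cluster_sector[OF reference_sector])

lemma sector_decomposition:
  assumes "c \<in> sector N"
  shows "c = J (J c) + (c $ occupied N) *\<^sub>R reference N"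
  using assms occupied_not_excited[of N]
  by (auto simp: vec_eq_iff J_J_nth reference_nth sector_def excited_def)

lemma linear_transformed: "linear (transformed t)"
  using linear_compose[OF linear_compose[OF linear_cluster_exp linear_H] linear_cluster_exp, of N "- t" N t]
  by (simp add: transformed_def[abs_def] comp_def)

lemma transformed_sector: "transformed t c \<in> sector N"
  unfolding transformed_def by (intro cluster_exp_sector H_sector)

lemma cluster_exp_transformed: "cluster_exp N t (transformed t c) = H (cluster_exp N t c)"
  by (simp add: transformed_def cluster_exp_inverse[OF N_le])

lemma cc_eq: "cc t = J (transformed t (reference N))"
  by (simp add: cc_def transformed_def)

lemma cc_has_derivative:
  "(cc has_derivative (\<lambda>h. J (transformed t (J h) - cluster N h (transformed t (reference N))))) (at t)"
proof -
  have blB: "bounded_linear (transformed t)" and blJ: "bounded_linear J"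
    using linear_transformed linear_J by (simp_all add: linear_conv_bounded_linear)
  have "((\<lambda>s. cluster_exp N (1 *\<^sub>R s) (reference N)) has_derivative (\<lambda>h. 0 + 1 *\<^sub>R cluster N h (reference N))) (at 0)"
    by (rule has_derivative_cluster_exp) (rule has_derivative_const)
  then have "((\<lambda>s. cluster_exp N s (reference N)) has_derivative J) (at 0)"
    by (simp add: J_def[abs_def])
  from has_derivative_cluster_exp[OF bounded_linear.has_derivative[OF blB this], of N "-1"]
  have "((\<lambda>s. cluster_exp N (- s) (transformed t (cluster_exp N s (reference N)))) has_derivative
      (\<lambda>h. transformed t (J h) - cluster N h (transformed t (reference N)))) (at 0)"
    by (simp add: cluster_exp_0)
  from bounded_linear.has_derivative[OF blJ this]
  have "((\<lambda>s. J (cluster_exp N (- s) (transformed t (cluster_exp N s (reference N))))) has_derivative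
      (\<lambda>h. J (transformed t (J h) - cluster N h (transformed t (reference N))))) (at 0)" .
  moreover have "J (cluster_exp N (- s) (transformed t (cluster_exp N s (reference N)))) = cc (t + s)" for s
  proof -
    have "- (t + s) = - s + - t" by simp
    then show ?thesis
      unfolding cc_def transformed_def by (simp only: cluster_exp_add[OF N_le])
  qed
  ultimately have d: "((\<lambda>s. cc (t + s)) has_derivative
      (\<lambda>h. J (transformed t (J h) - cluster N h (transformed t (reference N))))) (at (t - t))"
    by simp
  have "((\<lambda>x. x - t) has_derivative (\<lambda>h. h)) (at t)"
    by (auto intro!: derivative_eq_intros)
  from has_derivative_compose[OF this d] show ?thesis by simp
qed

lemma continuous_on_cc: "continuous_on UNIV cc"
proof -
  have "bounded_linear H" "bounded_linear J"
    using linear_H linear_J by (simp_all add: linear_conv_bounded_linear)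
  then show ?thesis
    unfolding cc_def[abs_def]
    by (intro bounded_linear.continuous_on[of J] continuous_on_cluster_exp bounded_linear.continuous_on[of H] continuous_intros)
qed

end

locale cc_solution = cc_operator +
  fixes t :: "real^('a set)"
  assumes t_amplitudes: "t \<in> amplitudes N" and cc_t: "cc t = 0"
begin

definition \<psi> :: "'a fock" where "\<psi> = cluster_exp N t (reference N)"

definition energy :: real where "energy = transformed t (reference N) $ occupied N"

definition L :: "real^('a set) \<Rightarrow> real^('a set)" where
  "L h = J (transformed t (J h) - energy *\<^sub>R J h)"

lemma transformed_reference: "transformed t (reference N) = energy *\<^sub>R reference N"
proof -
  have "J (J (transformed t (reference N))) = 0"
    using cc_t by (simp add: cc_eq linear_0[OF linear_J])
  then show ?thesis
    using sector_decomposition[OF transformed_sector, of t "reference N"] by (simp add: energy_def)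
qed

lemma H_\<psi>: "H \<psi> = energy *\<^sub>R \<psi>"
  using cluster_exp_transformed[of t "reference N"]
  by (simp add: \<psi>_def transformed_reference linear_cmul[OF linear_cluster_exp])

lemma \<psi>_occupied: "\<psi> $ occupied N = 1"
  by (simp add: \<psi>_def cluster_exp_nth_occupied[OF N_le] reference_nth)

lemma \<psi>_nonzero: "\<psi> \<noteq> 0"
  using \<psi>_occupied by auto

lemma \<psi>_sector: "\<psi> \<in> sector N"
  unfolding \<psi>_def by (rule cluster_exp_sector[OF reference_sector])

lemma cc_has_derivative_L: "(cc has_derivative L) (at t)"
proof -
  have "L = (\<lambda>h. J (transformed t (J h) - cluster N h (transformed t (reference N))))"
    by (simp add: fun_eq_iff L_def transformed_reference linear_cmul[OF linear_cluster] J_def)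
  then show ?thesis using cc_has_derivative[of t] by simp
qed

lemma linear_L: "linear L"
  using cc_has_derivative_L by (simp add: has_derivative_bounded_linear bounded_linear.linear)

lemma L_amplitudes: "L h \<in> amplitudes N"
  by (simp add: L_def J_amplitudes)

lemma exp_J_L:
  "\<exists>a. cluster_exp N t (J (L h)) = H (cluster_exp N t (J h)) - energy *\<^sub>R cluster_exp N t (J h) - a *\<^sub>R \<psi>"
proof -
  let ?y = "transformed t (J h) - energy *\<^sub>R J h"
  have "?y \<in> sector N"
    by (intro subspace_diff subspace_scale subspace_sector transformed_sector J_sector)
  from sector_decomposition[OF this]
  have "J (L h) = ?y - (?y $ occupied N) *\<^sub>R reference N" by (simp add: L_def algebra_simps)
  then have "cluster_exp N t (J (L h))
     = cluster_exp N t ?y - (?y $ occupied N) *\<^sub>R \<psi>"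
    by (simp only: linear_diff[OF linear_cluster_exp] linear_cmul[OF linear_cluster_exp] \<psi>_def)
  also have "cluster_exp N t ?y = H (cluster_exp N t (J h)) - energy *\<^sub>R cluster_exp N t (J h)"
    by (simp only: linear_diff[OF linear_cluster_exp] linear_cmul[OF linear_cluster_exp] cluster_exp_transformed)
  finally show ?thesis by blast
qed

lemma bij_L_iff:
  "bij_betw L (amplitudes N) (amplitudes N) \<longleftrightarrow> (\<forall>h\<in>amplitudes N. L h = 0 \<longrightarrow> h = 0)"
proof
  assume "bij_betw L (amplitudes N) (amplitudes N)"
  then have "inj_on L (amplitudes N)" by (rule bij_betw_imp_inj_on)
  then show "\<forall>h\<in>amplitudes N. L h = 0 \<longrightarrow> h = 0"
    using subspace_0[OF subspace_amplitudes] linear_0[OF linear_L] by (metis inj_onD)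
next
  assume ker: "\<forall>h\<in>amplitudes N. L h = 0 \<longrightarrow> h = 0"
  have inj: "inj_on L (amplitudes N)"
  proof (rule inj_onI)
    fix x y assume xy: "x \<in> amplitudes N" "y \<in> amplitudes N" "L x = L y"
    have "x - y \<in> amplitudes N" using xy by (intro subspace_diff subspace_amplitudes)
    moreover have "L (x - y) = 0" using xy by (simp add: linear_diff[OF linear_L])
    ultimately show "x = y" using ker by force
  qed
  moreover have "L ` amplitudes N = amplitudes N"
  proof (rule subspace_dim_equal)
    show "subspace (L ` amplitudes N)" by (intro linear_subspace_image linear_L subspace_amplitudes)
    show "subspace (amplitudes N :: (real^('a set)) set)" by (rule subspace_amplitudes)
    show "L ` amplitudes N \<subseteq> amplitudes N" using L_amplitudes by auto
    show "dim (L ` amplitudes N) \<ge> dim (amplitudes N :: (real^('a set)) set)"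
    proof -
      have "span (amplitudes N) = (amplitudes N :: (real^('a set)) set)"
        by (rule span_eq_iff[THEN iffD2, OF subspace_amplitudes])
      then have "dim (L ` amplitudes N) = dim (amplitudes N :: (real^('a set)) set)"
        using dim_image_eq[OF linear_L, of "amplitudes N"] inj by (simp only:)
      then show ?thesis by linarith
    qed
  qed
  ultimately show "bij_betw L (amplitudes N) (amplitudes N)" by (simp add: bij_betw_def)
qed

lemma nondegenerate_iff:
  "(\<exists>D. (cc has_derivative D) (at t within amplitudes N) \<and> bij_betw D (amplitudes N) (amplitudes N))
    \<longleftrightarrow> (\<forall>h\<in>amplitudes N. L h = 0 \<longrightarrow> h = 0)" (is "?l \<longleftrightarrow> ?r")
proof
  assume ?l
  then obtain D where D: "(cc has_derivative D) (at t within amplitudes N)"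
    and bij: "bij_betw D (amplitudes N) (amplitudes N)" by blast
  have "D v = L v" if v: "v \<in> amplitudes N" for v
  proof -
    let ?g = "\<lambda>s::real. t + s *\<^sub>R v"
    have g: "(?g has_derivative (\<lambda>s. s *\<^sub>R v)) (at 0)" by (auto intro!: derivative_eq_intros)
    have sub: "?g ` UNIV \<subseteq> amplitudes N"
      using t_amplitudes v by (auto intro!: subspace_add subspace_scale subspace_amplitudes)
    have "(cc has_derivative D) (at (?g 0) within ?g ` UNIV)"
      using has_derivative_subset[OF D sub] by simp
    from has_derivative_in_compose[OF g this]
    have "((\<lambda>s. cc (?g s)) has_derivative (\<lambda>s. D (s *\<^sub>R v))) (at 0)" by simp
    moreover have "((\<lambda>s. cc (?g s)) has_derivative (\<lambda>s. L (s *\<^sub>R v))) (at 0)"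
      by (rule has_derivative_compose[OF g]) (simp add: cc_has_derivative_L)
    ultimately have "(\<lambda>s. D (s *\<^sub>R v)) = (\<lambda>s. L (s *\<^sub>R v))" by (rule has_derivative_unique)
    from fun_cong[OF this, of 1] show ?thesis by simp
  qed
  then have "bij_betw L (amplitudes N) (amplitudes N)"
    using bij by (simp cong: bij_betw_cong)
  then show ?r by (simp add: bij_L_iff)
next
  assume ?r
  then show ?l using has_derivative_at_withinI[OF cc_has_derivative_L] bij_L_iff by blast
qed

lemma subspace_complement: "subspace (sector N \<inter> {x. \<psi> \<bullet> x = 0})"
  by (intro subspace_inter subspace_sector subspace_hyperplane)

lemma exists_eigenbasis:
  obtains b where "eigenbasis H (sector N \<inter> {x. \<psi> \<bullet> x = 0}) (b ` {..<card (excited N :: 'a set set)})"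
    "inj_on b {..<card (excited N :: 'a set set)}"
proof -
  let ?S = "sector N \<inter> {x. \<psi> \<bullet> x = 0}"
  have "H x \<in> ?S" if "x \<in> ?S" for x
    using that H_sector H_symmetric[of \<psi> x] by (simp add: H_\<psi>)
  then obtain B where B: "eigenbasis H ?S B"
    using symmetric_eigenbasis[OF linear_H subspace_complement] H_symmetric by blast
  define v where "v = \<psi> /\<^sub>R norm \<psi>"
  have v: "v \<in> sector N" "norm v = 1" "H v = energy *\<^sub>R v" and v_perp: "sector N \<inter> {x. v \<bullet> x = 0} = ?S"
    using \<psi>_nonzero \<psi>_sector
    by (auto simp: v_def linear_cmul[OF linear_H] H_\<psi> intro: subspace_scale[OF subspace_sector])
  note ins = eigenbasis_insert[OF B[folded v_perp] subspace_sector v]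
  have fin: "finite B" using B by (simp add: eigenbasis_def)
  have sets: "{S :: 'a set. card S = N} = insert (occupied N) (excited N)"
    using card_occupied[OF N_le] by (auto simp: excited_def)
  have "sector N = {x :: 'a fock. \<forall>S. S \<notin> {S. card S = N} \<longrightarrow> x $ S = 0}"
    by (auto simp: sector_def)
  then have "dim (sector N :: 'a fock set) = card {S :: 'a set. card S = N}"
    using dim_substandard_cart[of "{S :: 'a set. card S = N}", where 'a = real] by (simp add: dim_vec_eq)
  also have "\<dots> = Suc (card (excited N :: 'a set set))"
    unfolding sets by (simp add: occupied_not_excited)
  finally have "card B = card (excited N :: 'a set set)"
    using eigenbasis_card[OF ins(1)] ins(2) fin by simp
  then obtain b where "bij_betw b {..<card (excited N :: 'a set set)} B"
    using ex_bij_betw_nat_finite[OF fin] by (auto simp: atLeast0LessThan)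
  then show ?thesis using B that[of b] by (auto simp: bij_betw_def)
qed

end

locale cc_eigenbasis = cc_solution +
  fixes b :: "nat \<Rightarrow> 'a fock" and m :: nat
  assumes m: "m = card (excited N :: 'a set set)"
    and basis: "eigenbasis H (sector N \<inter> {x. \<psi> \<bullet> x = 0}) (b ` {..<m})"
    and inj_b: "inj_on b {..<m}"
begin

definition lam :: "nat \<Rightarrow> real" where "lam i = b i \<bullet> H (b i)"

lemma
  assumes "i < m"
  shows b_sector: "b i \<in> sector N" and b_perp: "\<psi> \<bullet> b i = 0" and b_norm: "norm (b i) = 1"
    and H_b: "H (b i) = lam i *\<^sub>R b i"
proof -
  have "span (b ` {..<m}) = sector N \<inter> {x. \<psi> \<bullet> x = 0}" using basis by (simp add: eigenbasis_def)
  then have "b i \<in> sector N \<inter> {x. \<psi> \<bullet> x = 0}" using assms span_base[of "b i" "b ` {..<m}"] by auto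
  then show "b i \<in> sector N" "\<psi> \<bullet> b i = 0" by auto
  show "norm (b i) = 1" "H (b i) = lam i *\<^sub>R b i" using basis assms by (auto simp: eigenbasis_def lam_def)
qed

definition Q :: "real^('a set) \<Rightarrow> nat \<Rightarrow> real" where
  "Q h i = b i \<bullet> cluster_exp N t (J h)"

definition R :: "'a fock \<Rightarrow> real^('a set)" where
  "R c = J (cluster_exp N (- t) c)"

lemma linear_Q: "linear (\<lambda>h. Q h i)"
  by (rule linearI) (simp_all add: Q_def linear_add[OF linear_J] linear_cmul[OF linear_J]
      linear_add[OF linear_cluster_exp] linear_cmul[OF linear_cluster_exp] inner_add_right)

lemma linear_R: "linear R"
  using linear_compose[OF linear_cluster_exp linear_J] by (simp add: R_def[abs_def] comp_def)

lemma R_amplitudes: "R c \<in> amplitudes N"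
  by (simp add: R_def J_amplitudes)

lemma Q_L:
  assumes i: "i < m"
  shows "Q (L h) i = (lam i - energy) * Q h i"
proof -
  obtain a where a: "cluster_exp N t (J (L h)) = H (cluster_exp N t (J h)) - energy *\<^sub>R cluster_exp N t (J h) - a *\<^sub>R \<psi>"
    using exp_J_L by blast
  have "b i \<bullet> H (cluster_exp N t (J h)) = lam i * Q h i"
    unfolding H_symmetric[symmetric] H_b[OF i] by (simp add: Q_def)
  moreover have "b i \<bullet> \<psi> = 0" using b_perp[OF i] by (simp add: inner_commute)
  ultimately show ?thesis unfolding Q_def[of "L h"] a by (simp add: inner_diff_right Q_def algebra_simps)
qed

lemma R_Q:
  assumes h: "h \<in> amplitudes N"
  shows "R (\<Sum>i<m. Q h i *\<^sub>R b i) = h"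
proof -
  let ?c = "cluster_exp N t (J h)"
  define a where "a = (\<psi> \<bullet> ?c) / (\<psi> \<bullet> \<psi>)"
  have pp: "\<psi> \<bullet> \<psi> \<noteq> 0" using \<psi>_nonzero by simp
  have "?c - a *\<^sub>R \<psi> \<in> sector N"
    by (intro subspace_diff subspace_scale subspace_sector cluster_exp_sector J_sector \<psi>_sector)
  then have "?c - a *\<^sub>R \<psi> \<in> sector N \<inter> {x. \<psi> \<bullet> x = 0}"
    using pp by (simp add: inner_diff_right a_def)
  from eigenbasis_expand[OF basis this]
  have "?c - a *\<^sub>R \<psi> = (\<Sum>i<m. (b i \<bullet> (?c - a *\<^sub>R \<psi>)) *\<^sub>R b i)"
    by (simp add: sum.reindex[OF inj_b])
  also have "\<dots> = (\<Sum>i<m. Q h i *\<^sub>R b i)"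
    using b_perp by (intro sum.cong) (auto simp: inner_diff_right Q_def inner_commute)
  finally have "(\<Sum>i<m. Q h i *\<^sub>R b i) = ?c - a *\<^sub>R \<psi>" by simp
  then have "R (\<Sum>i<m. Q h i *\<^sub>R b i) = R ?c - a *\<^sub>R R \<psi>"
    by (simp add: linear_diff[OF linear_R] linear_cmul[OF linear_R])
  also have "R ?c = h" by (simp add: R_def cluster_exp_inverse[OF N_le] J_J_id h)
  also have "R \<psi> = 0" by (simp add: R_def \<psi>_def cluster_exp_inverse[OF N_le] J_reference)
  finally show ?thesis by simp
qed

lemma Q_eq_0:
  assumes "h \<in> amplitudes N" "\<And>i. i < m \<Longrightarrow> Q h i = 0"
  shows "h = 0"
  using R_Q[OF assms(1)] assms(2) by (simp add: linear_0[OF linear_R])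

lemma L_injective_iff:
  "(\<forall>h\<in>amplitudes N. L h = 0 \<longrightarrow> h = 0) \<longleftrightarrow> (\<forall>i<m. lam i \<noteq> energy)"
proof
  assume ne: "\<forall>i<m. lam i \<noteq> energy"
  show "\<forall>h\<in>amplitudes N. L h = 0 \<longrightarrow> h = 0"
  proof (intro ballI impI)
    fix h assume h: "h \<in> amplitudes N" "L h = 0"
    have "Q h i = 0" if "i < m" for i
      using Q_L[OF that, of h] ne that by (simp add: h(2) linear_0[OF linear_Q])
    then show "h = 0" by (rule Q_eq_0[OF h(1)])
  qed
next
  assume ker: "\<forall>h\<in>amplitudes N. L h = 0 \<longrightarrow> h = 0"
  show "\<forall>i<m. lam i \<noteq> energy"
  proof (intro allI impI notI)
    fix i assume i: "i < m" and eq: "lam i = energy"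
    let ?x = "cluster_exp N (- t) (b i)"
    have "?x \<in> sector N" by (intro cluster_exp_sector b_sector i)
    from sector_decomposition[OF this] obtain a where a: "J (R (b i)) = ?x - a *\<^sub>R reference N"
      by (metis R_def add_diff_cancel_right')
    have "transformed t ?x = energy *\<^sub>R ?x"
      by (simp add: transformed_def cluster_exp_inverse[OF N_le] H_b[OF i] eq linear_cmul[OF linear_cluster_exp])
    then have "L (R (b i)) = 0"
      by (simp add: L_def a linear_diff[OF linear_transformed] linear_cmul[OF linear_transformed]
          transformed_reference scaleR_diff_right linear_0[OF linear_J] mult.commute)
    with ker R_amplitudes have "R (b i) = 0" by blast
    then have "?x = a *\<^sub>R reference N" using a by (simp add: linear_0[OF linear_J])
    then have "cluster_exp N t ?x = a *\<^sub>R \<psi>" by (simp add: linear_cmul[OF linear_cluster_exp] \<psi>_def)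
    then have "b i = a *\<^sub>R \<psi>" by (simp add: cluster_exp_inverse[OF N_le])
    then have "b i \<bullet> b i = 0" using b_perp[OF i] by simp
    with b_norm[OF i] show False by simp
  qed
qed

lemma eigenbasis_sector:
  "eigenbasis H (sector N) (insert (\<psi> /\<^sub>R norm \<psi>) (b ` {..<m}))" "\<psi> /\<^sub>R norm \<psi> \<notin> b ` {..<m}"
  "(\<psi> /\<^sub>R norm \<psi>) \<bullet> H (\<psi> /\<^sub>R norm \<psi>) = energy"
proof -
  define v where "v = \<psi> /\<^sub>R norm \<psi>"
  have v: "v \<in> sector N" "norm v = 1" "H v = energy *\<^sub>R v"
    and v_perp: "sector N \<inter> {x. v \<bullet> x = 0} = sector N \<inter> {x. \<psi> \<bullet> x = 0}"
    using \<psi>_nonzero \<psi>_sector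
    by (auto simp: v_def linear_cmul[OF linear_H] H_\<psi> intro: subspace_scale[OF subspace_sector])
  from eigenbasis_insert[OF basis[folded v_perp] subspace_sector v]
  show "eigenbasis H (sector N) (insert v (b ` {..<m}))" "v \<notin> b ` {..<m}" .
  show "v \<bullet> H v = energy" using v by (simp add: dot_square_norm)
qed

definition spectrum :: "real multiset" where
  "spectrum = add_mset energy (image_mset lam (mset_set {..<m}))"

lemma dim_eigenspace_count: "dim {c \<in> sector N. H c = E *\<^sub>R c} = count spectrum E"
proof -
  let ?v = "\<psi> /\<^sub>R norm \<psi>"
  have "dim {c \<in> sector N. H c = E *\<^sub>R c} = card {x \<in> insert ?v (b ` {..<m}). x \<bullet> H x = E}"
    by (rule dim_eigenspace[OF eigenbasis_sector(1) subspace_sector linear_H H_symmetric])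
  also have "{x \<in> insert ?v (b ` {..<m}). x \<bullet> H x = E}
     = (if energy = E then {?v} else {}) \<union> b ` {i. i < m \<and> lam i = E}"
    using eigenbasis_sector(3) by (auto simp: lam_def)
  also have "card \<dots> = (if energy = E then 1 else 0) + card {i. i < m \<and> lam i = E}"
    using eigenbasis_sector(2) card_image[OF inj_on_subset[OF inj_b], of "{i. i < m \<and> lam i = E}"]
    by (subst card_Un_disjoint) auto
  also have "card {i. i < m \<and> lam i = E} = count (image_mset lam (mset_set {..<m})) E"
  proof -
    have "lam -` {E} \<inter> {..<m} = {i. i < m \<and> lam i = E}" by auto
    moreover have "(\<Sum>i\<in>lam -` {E} \<inter> {..<m}. count (mset_set {..<m}) i) = (\<Sum>i\<in>lam -` {E} \<inter> {..<m}. 1)"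
      by (rule sum.cong) auto
    ultimately show ?thesis by (simp add: count_image_mset)
  qed
  also have "(if energy = E then 1 else 0) + \<dots> = count spectrum E"
    by (simp add: spectrum_def)
  finally show ?thesis .
qed

lemma count_spectrum_energy: "count spectrum energy = 1 \<longleftrightarrow> (\<forall>i<m. lam i \<noteq> energy)"
proof -
  have "count spectrum energy = 1 \<longleftrightarrow> energy \<notin> lam ` {..<m}"
    by (simp add: spectrum_def count_eq_zero_iff)
  then show ?thesis by (metis imageE imageI lessThan_iff)
qed

lemma size_spectrum_below:
  "size {#x \<in># spectrum. x < energy#} = card {i. i < m \<and> lam i < energy}"
proof -
  have "{i \<in> {..<m}. lam i < energy} = {i. i < m \<and> lam i < energy}" by auto
  then show ?thesis by (simp add: spectrum_def filter_mset_image_mset)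
qed

lemma L_bounded_below:
  assumes ne: "\<forall>i<m. lam i \<noteq> energy"
  obtains \<epsilon> where "\<epsilon> > 0" "\<And>h. h \<in> amplitudes N \<Longrightarrow> \<epsilon> * norm h \<le> norm (L h)"
proof -
  have "closed (amplitudes N :: (real^('a set)) set)" by (intro closed_subspace subspace_amplitudes)
  moreover have "bounded_linear L" using linear_L by (simp add: linear_conv_bounded_linear)
  moreover have "\<forall>h\<in>amplitudes N. L h = 0 \<longrightarrow> h = 0" using ne L_injective_iff by blast
  ultimately show ?thesis
    using injective_imp_isometric[of "amplitudes N" L] subspace_amplitudes that by (metis mult.commute)
qed

lemma cc_homotopy:
  assumes ne: "\<forall>i<m. lam i \<noteq> energy"
  obtains \<delta> where "\<delta> > 0" "\<And>r h s. h \<in> amplitudes N \<Longrightarrow> norm h = 1 \<Longrightarrow> 0 < r \<Longrightarrow> r < \<delta> \<Longrightarrow> 0 \<le> s \<Longrightarrow> s \<le> 1 \<Longrightarrow>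
     (1 - s) *\<^sub>R cc (t + r *\<^sub>R h) + s *\<^sub>R L h \<noteq> 0"
proof -
  obtain \<epsilon> where \<epsilon>: "\<epsilon> > 0" "\<And>h. h \<in> amplitudes N \<Longrightarrow> \<epsilon> * norm h \<le> norm (L h)"
    using L_bounded_below[OF ne] by blast
  have "\<exists>d>0. \<forall>y. norm (y - t) < d \<longrightarrow> norm (cc y - cc t - L (y - t)) \<le> \<epsilon> / 2 * norm (y - t)"
    using cc_has_derivative_L[unfolded has_derivative_at_alt] \<epsilon>(1) half_gt_zero by blast
  then obtain \<delta> where \<delta>: "\<delta> > 0"
    "\<And>y. norm (y - t) < \<delta> \<Longrightarrow> norm (cc y - L (y - t)) \<le> \<epsilon> / 2 * norm (y - t)"
    by (auto simp: cc_t)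
  show ?thesis
  proof (rule that[OF \<delta>(1)])
    fix r s :: real and h :: "real^('a set)" assume h: "h \<in> amplitudes N" "norm h = 1" and r: "0 < r" "r < \<delta>" and s: "0 \<le> s" "s \<le> 1"
    define err where "err = cc (t + r *\<^sub>R h) - r *\<^sub>R L h"
    have err: "norm err \<le> \<epsilon> / 2 * r"
      using \<delta>(2)[of "t + r *\<^sub>R h"] h r by (simp add: err_def linear_cmul[OF linear_L])
    show "(1 - s) *\<^sub>R cc (t + r *\<^sub>R h) + s *\<^sub>R L h \<noteq> 0"
    proof
      assume "(1 - s) *\<^sub>R cc (t + r *\<^sub>R h) + s *\<^sub>R L h = 0"
      then have "((1 - s) * r + s) *\<^sub>R L h = - ((1 - s) *\<^sub>R err)"
        by (simp add: err_def algebra_simps add_eq_0_iff)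
      then have "norm (((1 - s) * r + s) *\<^sub>R L h) = norm ((1 - s) *\<^sub>R err)" by simp
      then have "((1 - s) * r + s) * norm (L h) = (1 - s) * norm err" using r s by simp
      also have "\<dots> \<le> (1 - s) * (\<epsilon> / 2 * r)" using err s by (intro mult_left_mono) auto
      finally have 1: "((1 - s) * r + s) * norm (L h) \<le> (1 - s) * (\<epsilon> / 2 * r)" .
      have "((1 - s) * r + s) * \<epsilon> \<le> ((1 - s) * r + s) * norm (L h)"
        using \<epsilon>(2)[OF h(1)] h(2) r s by (intro mult_left_mono) auto
      with 1 have "((1 - s) * r + s) * \<epsilon> \<le> (1 - s) * (\<epsilon> / 2 * r)" by linarith
      moreover have "((1 - s) * r / 2 + s) * \<epsilon> = ((1 - s) * r + s) * \<epsilon> - (1 - s) * (\<epsilon> / 2 * r)"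
        by (simp add: field_simps)
      ultimately have "((1 - s) * r / 2 + s) * \<epsilon> \<le> 0" by linarith
      moreover have "(1 - s) * r / 2 + s > 0"
        using r s by (cases "s = 0") (auto intro: add_nonneg_pos)
      ultimately show False using \<epsilon>(1) by (simp add: mult_le_0_iff)
    qed
  qed
qed

lemma cc_isolated:
  assumes ne: "\<forall>i<m. lam i \<noteq> energy"
  shows "\<exists>r>0. \<forall>s\<in>amplitudes N. cc s = 0 \<and> dist s t < r \<longrightarrow> s = t"
proof -
  obtain \<delta> where \<delta>: "\<delta> > 0" "\<And>r h s. h \<in> amplitudes N \<Longrightarrow> norm h = 1 \<Longrightarrow> 0 < r \<Longrightarrow> r < \<delta> \<Longrightarrow> 0 \<le> s \<Longrightarrow> s \<le> 1 \<Longrightarrow>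
     (1 - s) *\<^sub>R cc (t + r *\<^sub>R h) + s *\<^sub>R L h \<noteq> 0"
    by (rule cc_homotopy[OF ne]) blast
  show ?thesis
  proof (rule exI[of _ \<delta>], intro conjI ballI impI)
    show "0 < \<delta>" by (rule \<delta>(1))
  next
    fix s assume s: "s \<in> amplitudes N" "cc s = 0 \<and> dist s t < \<delta>"
    show "s = t"
    proof (rule ccontr)
      assume "s \<noteq> t"
      let ?h = "(s - t) /\<^sub>R norm (s - t)"
      have "?h \<in> amplitudes N"
        using s t_amplitudes by (intro subspace_scale subspace_diff subspace_amplitudes) auto
      moreover have "norm ?h = 1" "0 < norm (s - t)" "norm (s - t) < \<delta>"
        using \<open>s \<noteq> t\<close> s by (auto simp: dist_norm)
      ultimately have "cc (t + norm (s - t) *\<^sub>R ?h) \<noteq> 0" using \<delta>(2)[of ?h "norm (s - t)" 0] by simp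
      then show False using s \<open>s \<noteq> t\<close> by simp
    qed
  qed
qed

end

lemma
  assumes e: "bij_betw e {..<m} (excited N)"
  shows of_coords_nth: "i < m \<Longrightarrow> of_coords m e x $ e i = x i"
    and of_coords_amplitudes: "of_coords m e x \<in> amplitudes N"
    and of_coords_to_coords: "s \<in> amplitudes N \<Longrightarrow> of_coords m e (to_coords m e s) = s"
    and norm_of_coords: "(norm (of_coords m e x))\<^sup>2 = (\<Sum>i<m. (x i)\<^sup>2)"
    and amplitudes_nonzero: "s \<in> amplitudes N \<Longrightarrow> s \<noteq> 0 \<Longrightarrow> \<exists>i<m. s $ e i \<noteq> 0"
proof -
  have inj: "inj_on e {..<m}" and im: "e ` {..<m} = excited N" using e by (auto simp: bij_betw_def)
  show nth: "of_coords m e x $ e i = x i" if i: "i < m" for i x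
  proof -
    have "of_coords m e x $ e i = (\<Sum>j<m. if j = i then x i else 0)"
      unfolding of_coords_def sum_component using inj i
      by (intro sum.cong) (auto simp: axis_def inj_on_def)
    then show ?thesis using i by simp
  qed
  show amp: "of_coords m e x \<in> amplitudes N" for x
    using im by (auto simp: amplitudes_def of_coords_def axis_def intro!: sum.neutral)
  have ext: "s = s'" if "s \<in> amplitudes N" "s' \<in> amplitudes N" "\<And>i. i < m \<Longrightarrow> s $ e i = s' $ e i" for s s'
  proof -
    have "s $ \<alpha> = s' $ \<alpha>" for \<alpha>
    proof (cases "\<alpha> \<in> excited N")
      case True
      then obtain i where "i < m" "\<alpha> = e i" using im by auto
      then show ?thesis using that(3) by simp
    qed (use that in \<open>simp add: amplitudes_def\<close>)
    then show ?thesis by (simp add: vec_eq_iff)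
  qed
  show "of_coords m e (to_coords m e s) = s" if "s \<in> amplitudes N" for s
    by (rule ext[OF amp that]) (simp add: nth to_coords_def)
  show "\<exists>i<m. s $ e i \<noteq> 0" if "s \<in> amplitudes N" "s \<noteq> 0" for s
    using ext[OF that(1), of 0] that(2) by (auto simp: amplitudes_def)
  show "(norm (of_coords m e x))\<^sup>2 = (\<Sum>i<m. (x i)\<^sup>2)" for x
  proof -
    have "(norm (of_coords m e x))\<^sup>2 = (\<Sum>\<alpha>\<in>UNIV. (of_coords m e x $ \<alpha>)\<^sup>2)"
      unfolding power2_norm_eq_inner inner_vec_def by (simp add: power2_eq_square)
    also have "\<dots> = (\<Sum>\<alpha>\<in>excited N. (of_coords m e x $ \<alpha>)\<^sup>2)"
      using amp[of x] by (intro sum.mono_neutral_right) (auto simp: amplitudes_def)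
    also have "\<dots> = (\<Sum>i<m. (of_coords m e x $ e i)\<^sup>2)"
      unfolding im[symmetric] by (simp add: sum.reindex[OF inj])
    also have "\<dots> = (\<Sum>i<m. (x i)\<^sup>2)" by (simp add: nth)
    finally show ?thesis .
  qed
qed

lemma continuous_map_of_coords: "continuous_map (nsphere p) euclidean (of_coords m e)"
proof -
  have "continuous_map (nsphere p) euclidean (\<lambda>x. x i *\<^sub>R v)" for i and v :: "'b::real_normed_vector"
    using continuous_map_nsphere_projection[of p i]
    by (simp add: continuous_map_atin tendsto_scaleR)
  then show ?thesis
    unfolding of_coords_def[abs_def] by (intro continuous_map_sum) auto
qed

context cc_eigenbasis
begin

theorem zero_index_cc:
  assumes ne: "\<forall>i<m. lam i \<noteq> energy" and e: "bij_betw e {..<m} (excited N)"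
  shows "zero_index m (\<lambda>x. to_coords m e (cc (of_coords m e x))) (to_coords m e t)
    = (- 1) ^ card {i. i < m \<and> lam i < energy}"
proof (cases m)
  case 0
  then show ?thesis by (intro zero_index_eqI) (simp add: ball_degree_def)
next
  case (Suc p)
  note oc = of_coords_nth[OF e] of_coords_amplitudes[OF e] of_coords_to_coords[OF e]
  have le: "i \<le> p \<longleftrightarrow> i < m" for i using Suc by auto
  have ms: "{..<m} = {..p}" using le by auto
  have oc_sum: "of_coords m e x = (\<Sum>j\<le>p. x j *\<^sub>R axis (e j) 1)" for x
    by (simp add: of_coords_def ms)
  define F where "F x i = (if i \<le> p then L (of_coords m e x) $ e i else 0)" for x i
  define D where "D x i = (if i \<le> p then (lam i - energy) * x i else 0)" for x :: "nat \<Rightarrow> real" and i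
  define q where "q x i = (if i \<le> p then Q (of_coords m e x) i else 0)" for x i
  define \<rho> where "\<rho> x i = (if i \<le> p then R (\<Sum>j\<le>p. x j *\<^sub>R b j) $ e i else 0)" for x i
  have nz: "of_coords m e x \<noteq> 0" if x: "x \<in> topspace (nsphere p)" for x
    using nsphere_nonzero[OF x] oc(1) by (auto simp: le) (metis zero_index)
  have lin_nth: "linear (\<lambda>x. f x $ \<alpha>)" if "linear f" for f :: "'b::real_vector \<Rightarrow> real^('a set)" and \<alpha>
    using that by (auto intro!: linearI simp: linear_add linear_cmul)
  have F: "sphere_map p F"
    unfolding F_def[abs_def] oc_sum
  proof (rule sphere_map_linear)
    fix x assume x: "x \<in> topspace (nsphere p)"
    have "L (of_coords m e x) \<noteq> 0" using L_injective_iff ne nz[OF x] oc(2) by blast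
    from amplitudes_nonzero[OF e L_amplitudes this]
    show "\<exists>i\<le>p. L (\<Sum>j\<le>p. x j *\<^sub>R axis (e j) 1) $ e i \<noteq> 0" by (auto simp: le oc_sum)
  qed (intro lin_nth linear_L)
  have D: "sphere_map p D"
    unfolding D_def[abs_def] using ne by (intro sphere_map_diagonal) (simp add: le)
  have q: "sphere_map p q"
    unfolding q_def[abs_def] oc_sum
  proof (rule sphere_map_linear)
    fix x assume x: "x \<in> topspace (nsphere p)"
    show "\<exists>i\<le>p. Q (\<Sum>j\<le>p. x j *\<^sub>R axis (e j) 1) i \<noteq> 0"
      using Q_eq_0[OF oc(2)] nz[OF x] by (auto simp: le oc_sum)
  qed (intro linear_Q)
  have \<rho>q: "\<rho> (q x) = x" if "\<forall>i>p. x i = 0" for x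
  proof
    fix i
    have "(\<Sum>j\<le>p. q x j *\<^sub>R b j) = (\<Sum>j<m. Q (of_coords m e x) j *\<^sub>R b j)"
      unfolding ms by (simp add: q_def)
    then have "R (\<Sum>j\<le>p. q x j *\<^sub>R b j) = of_coords m e x" using R_Q[OF oc(2)] by simp
    moreover have "of_coords m e x $ e i = x i" if "i \<le> p" using that oc(1) by (simp add: le)
    ultimately show "\<rho> (q x) i = x i" using that by (simp add: \<rho>_def)
  qed
  have b_indep: "x i = 0" if "(\<Sum>j<m. x j *\<^sub>R b j) = 0" "i < m" for x i
  proof -
    have "b i \<bullet> (\<Sum>j<m. x j *\<^sub>R b j) = (\<Sum>j<m. if j = i then x i else 0)"
      unfolding inner_sum_right
    proof (intro sum.cong refl)
      fix j assume j: "j \<in> {..<m}"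
      have "b i \<bullet> b j = 0" if "j \<noteq> i"
        using basis that j \<open>i < m\<close> inj_b by (auto simp: eigenbasis_def pairwise_def orthogonal_def inj_on_def)
      then show "b i \<bullet> x j *\<^sub>R b j = (if j = i then x i else 0)"
        using b_norm[OF \<open>i < m\<close>] by (auto simp: dot_square_norm)
    qed
    then show ?thesis using that by simp
  qed
  have \<rho>: "sphere_map p \<rho>"
    unfolding \<rho>_def[abs_def]
  proof (rule sphere_map_linear)
    fix x assume x: "x \<in> topspace (nsphere p)"
    let ?c = "\<Sum>j<m. x j *\<^sub>R b j"
    have "R ?c \<noteq> 0"
    proof
      assume R0: "R ?c = 0"
      have c: "?c \<in> sector N" by (intro subspace_sum subspace_scale subspace_sector b_sector) simp
      have "cluster_exp N (- t) ?c \<in> sector N" by (rule cluster_exp_sector[OF c])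
      from sector_decomposition[OF this] obtain a where "cluster_exp N (- t) ?c = a *\<^sub>R reference N"
        using R0 by (simp add: R_def linear_0[OF linear_J])
      then have "cluster_exp N t (cluster_exp N (- t) ?c) = a *\<^sub>R \<psi>"
        by (simp add: linear_cmul[OF linear_cluster_exp] \<psi>_def)
      then have ca: "?c = a *\<^sub>R \<psi>" by (simp add: cluster_exp_inverse[OF N_le])
      have "\<psi> \<bullet> ?c = 0" by (simp add: inner_sum_right b_perp)
      then have "?c = 0" using ca \<psi>_nonzero by auto
      then have "x i = 0" if "i \<le> p" for i using b_indep that le by blast
      then show False using nsphere_nonzero[OF x] by blast
    qed
    from amplitudes_nonzero[OF e R_amplitudes this]
    show "\<exists>i\<le>p. R (\<Sum>j\<le>p. x j *\<^sub>R b j) $ e i \<noteq> 0"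
      unfolding le ms by auto
  qed (intro lin_nth linear_R)
  have "zero_index m (\<lambda>x. to_coords m e (cc (of_coords m e x))) (to_coords m e t) = sphere_degree p F"
  proof -
    obtain \<delta> where \<delta>: "\<delta> > 0" "\<And>r h s. h \<in> amplitudes N \<Longrightarrow> norm h = 1 \<Longrightarrow> 0 < r \<Longrightarrow> r < \<delta> \<Longrightarrow> 0 \<le> s \<Longrightarrow> s \<le> 1 \<Longrightarrow>
       (1 - s) *\<^sub>R cc (t + r *\<^sub>R h) + s *\<^sub>R L h \<noteq> 0"
      by (rule cc_homotopy[OF ne]) blast
    have line: "of_coords m e (\<lambda>i. to_coords m e t i + r * x i) = t + r *\<^sub>R of_coords m e x" for r x
    proof -
      have "of_coords m e (\<lambda>i. to_coords m e t i + r * x i) = of_coords m e (to_coords m e t) + r *\<^sub>R of_coords m e x"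
        by (simp add: of_coords_def scaleR_left_distrib sum.distrib scaleR_sum_right)
      then show ?thesis by (simp add: oc(3)[OF t_amplitudes])
    qed
    have "zero_index (Suc p) (\<lambda>x. to_coords m e (cc (of_coords m e x))) (to_coords m e t) = sphere_degree p F"
    proof (rule zero_index_eq_sphere_degree[OF F \<delta>(1)])
      fix r :: real and i assume "i \<le> p"
      have "continuous_on UNIV (\<lambda>y. cc (t + r *\<^sub>R y))"
        by (intro continuous_on_compose2[OF continuous_on_cc] continuous_intros) auto
      from continuous_on_component[OF this]
      have "continuous_on UNIV (\<lambda>y. cc (t + r *\<^sub>R y) $ e i)" .
      then have "continuous_map euclidean euclideanreal (\<lambda>y. cc (t + r *\<^sub>R y) $ e i)" by simp
      from continuous_map_compose[OF continuous_map_of_coords this, of p m e]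
      show "continuous_map (nsphere p) euclideanreal
         (\<lambda>x. to_coords m e (cc (of_coords m e (\<lambda>i. to_coords m e t i + r * x i))) i)"
        using \<open>i \<le> p\<close> unfolding line by (simp add: to_coords_def le comp_def)
    next
      fix r s :: real and x assume r: "0 < r" "r < \<delta>" and x: "x \<in> topspace (nsphere p)" and s: "0 \<le> s" "s \<le> 1"
      let ?h = "of_coords m e x"
      have "(norm ?h)\<^sup>2 = 1"
        using x unfolding norm_of_coords[OF e] ms by (simp add: topspace_nsphere)
      then have "norm ?h = 1" by (simp add: power2_eq_1_iff) (use norm_ge_zero[of ?h] in linarith)
      from \<delta>(2)[OF oc(2) this r s] have "(1 - s) *\<^sub>R cc (t + r *\<^sub>R ?h) + s *\<^sub>R L ?h \<noteq> 0" .
      moreover have "(1 - s) *\<^sub>R cc (t + r *\<^sub>R ?h) + s *\<^sub>R L ?h \<in> amplitudes N"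
        by (intro subspace_add subspace_scale subspace_amplitudes L_amplitudes) (simp add: cc_def J_amplitudes)
      ultimately obtain i where "i < m" "((1 - s) *\<^sub>R cc (t + r *\<^sub>R ?h) + s *\<^sub>R L ?h) $ e i \<noteq> 0"
        using amplitudes_nonzero[OF e] by blast
      then show "\<exists>i\<le>p. (1 - s) * to_coords m e (cc (of_coords m e (\<lambda>i. to_coords m e t i + r * x i))) i + s * F x i \<noteq> 0"
        unfolding line by (intro exI[of _ i]) (simp add: to_coords_def F_def le)
    qed
    then show ?thesis by (simp add: Suc)
  qed
  also have "\<dots> = sphere_degree p D"
  proof (rule sphere_degree_conjugate[OF F D q \<rho> \<rho>q])
    fix x :: "nat \<Rightarrow> real" assume "\<forall>i>p. x i = 0"
    have "F x = to_coords m e (L (of_coords m e x))" by (auto simp: F_def to_coords_def fun_eq_iff le)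
    then have "of_coords m e (F x) = L (of_coords m e x)" by (simp add: oc(3)[OF L_amplitudes])
    then show "q (F x) = D (q x)" by (auto simp: q_def D_def fun_eq_iff Q_L le)
  qed
  also have "\<dots> = (- 1) ^ card {i. i \<le> p \<and> lam i - energy < 0}"
    unfolding D_def[abs_def] using ne by (intro sphere_degree_diagonal) (simp add: le)
  finally show ?thesis by (simp add: le)
qed

end


lemma energy_form_commute: "energy_form V w \<Phi> \<Psi> = energy_form V w \<Psi> \<Phi>"
  by (simp add: energy_form_def mult_ac)

lemma cc_operator_HK:
  fixes \<phi> :: "'k::{finite,linorder} \<Rightarrow> real^3 \<Rightarrow> real"
  assumes "CARD('n::{finite,linorder}) \<le> CARD('k)"
  shows "cc_operator CARD('n) (HK TYPE('n) \<phi> V w)"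
proof (rule cc_operator.intro)
  let ?N = "CARD('n)"
  let ?h = "\<lambda>\<alpha> \<beta>. energy_form V w (slater \<phi> \<alpha> :: 'n config \<Rightarrow> real) (slater \<phi> \<beta>)"
  show "CARD('n) \<le> CARD('k)" by (rule assms)
  show "linear (HK TYPE('n) \<phi> V w)"
    by (rule linearI) (auto simp: HK_def vec_eq_iff sum.distrib sum_distrib_left algebra_simps)
  show "HK TYPE('n) \<phi> V w c \<in> sector ?N" for c
    by (simp add: HK_def sector_def)
  have inner: "HK TYPE('n) \<phi> V w c \<bullet> d
      = (\<Sum>\<beta> | card \<beta> = ?N. \<Sum>\<alpha> | card \<alpha> = ?N. c $ \<alpha> * ?h \<alpha> \<beta> * d $ \<beta>)" for c d
  proof -
    have "HK TYPE('n) \<phi> V w c \<bullet> d = (\<Sum>\<beta>\<in>UNIV. HK TYPE('n) \<phi> V w c $ \<beta> * d $ \<beta>)"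
      by (simp add: inner_vec_def)
    also have "\<dots> = (\<Sum>\<beta> | card \<beta> = ?N. HK TYPE('n) \<phi> V w c $ \<beta> * d $ \<beta>)"
      by (intro sum.mono_neutral_right) (auto simp: HK_def)
    also have "\<dots> = (\<Sum>\<beta> | card \<beta> = ?N. \<Sum>\<alpha> | card \<alpha> = ?N. c $ \<alpha> * ?h \<alpha> \<beta> * d $ \<beta>)"
      by (intro sum.cong) (auto simp: HK_def sum_distrib_right)
    finally show ?thesis .
  qed
  show "HK TYPE('n) \<phi> V w c \<bullet> d = c \<bullet> HK TYPE('n) \<phi> V w d" for c d
  proof -
    have "HK TYPE('n) \<phi> V w c \<bullet> d
        = (\<Sum>\<alpha> | card \<alpha> = ?N. \<Sum>\<beta> | card \<beta> = ?N. c $ \<alpha> * ?h \<alpha> \<beta> * d $ \<beta>)"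
      unfolding inner by (rule sum.swap)
    also have "\<dots> = (\<Sum>\<alpha> | card \<alpha> = ?N. \<Sum>\<beta> | card \<beta> = ?N. d $ \<beta> * ?h \<beta> \<alpha> * c $ \<alpha>)"
      by (intro sum.cong refl) (subst energy_form_commute, simp)
    also have "\<dots> = HK TYPE('n) \<phi> V w d \<bullet> c" by (rule inner[symmetric])
    finally show ?thesis by (simp add: inner_commute)
  qed
qed

lemma cc_map_eq_inner:
  fixes \<phi> :: "'k::{finite,linorder} \<Rightarrow> real^3 \<Rightarrow> real"
  assumes N: "CARD('n::{finite,linorder}) \<le> CARD('k)"
    and L2: "\<And>p. \<phi> p \<in> L2"
    and on: "\<And>p q. L2_inner (\<phi> p) (\<phi> q) = (if p = q then 1 else 0)"
  shows "cc_map TYPE('n) \<phi> V w t s = cc_operator.cc CARD('n) (HK TYPE('n) \<phi> V w) t \<bullet> s"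
proof -
  let ?N = "CARD('n)"
  interpret cc_operator ?N "HK TYPE('n) \<phi> V w" by (rule cc_operator_HK[OF N])
  let ?g = "transformed t (reference ?N)"
  have "cc_map TYPE('n) \<phi> V w t s = (\<Sum>\<alpha> | card \<alpha> = ?N. ?g $ \<alpha> * J s $ \<alpha>)"
    unfolding cc_map_def Let_def exp_op_cluster[OF N] exp_op_minus_cluster[OF N]
      L2_inner_wavefunction[OF L2 on] transformed_def J_def ..
  also have "\<dots> = (\<Sum>\<alpha>\<in>UNIV. ?g $ \<alpha> * J s $ \<alpha>)"
    using J_sector[of s] by (intro sum.mono_neutral_left) (auto simp: sector_def)
  also have "\<dots> = (\<Sum>\<alpha>\<in>UNIV. cc t $ \<alpha> * s $ \<alpha>)"
    by (intro sum.cong refl) (simp add: cc_eq J_nth)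
  finally show ?thesis by (simp add: inner_vec_def)
qed

lemma cc_vec_eq:
  fixes \<phi> :: "'k::{finite,linorder} \<Rightarrow> real^3 \<Rightarrow> real"
  assumes N: "CARD('n::{finite,linorder}) \<le> CARD('k)"
    and L2: "\<And>p. \<phi> p \<in> L2"
    and on: "\<And>p q. L2_inner (\<phi> p) (\<phi> q) = (if p = q then 1 else 0)"
  shows "cc_vec TYPE('n) \<phi> V w = cc_operator.cc CARD('n) (HK TYPE('n) \<phi> V w)"
proof -
  interpret cc_operator "CARD('n)" "HK TYPE('n) \<phi> V w" by (rule cc_operator_HK[OF N])
  show ?thesis
    by (auto simp: fun_eq_iff vec_eq_iff cc_vec_def cc_map_eq_inner[OF N L2 on] inner_axis cc_eq J_nth)
qed

lemma cc_zero_iff: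
  fixes \<phi> :: "'k::{finite,linorder} \<Rightarrow> real^3 \<Rightarrow> real"
  assumes N: "CARD('n::{finite,linorder}) \<le> CARD('k)"
    and L2: "\<And>p. \<phi> p \<in> L2"
    and on: "\<And>p q. L2_inner (\<phi> p) (\<phi> q) = (if p = q then 1 else 0)"
  shows "cc_zero TYPE('n) \<phi> V w t \<longleftrightarrow>
    t \<in> amplitudes CARD('n) \<and> cc_operator.cc CARD('n) (HK TYPE('n) \<phi> V w) t = 0"
proof -
  interpret cc_operator "CARD('n)" "HK TYPE('n) \<phi> V w" by (rule cc_operator_HK[OF N])
  have "cc t \<in> amplitudes CARD('n)" by (simp add: cc_eq J_amplitudes)
  then show ?thesis
    unfolding cc_zero_def cc_map_eq_inner[OF N L2 on] by (metis inner_eq_zero_iff inner_zero_left)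
qed

theorem theorem4p15:
  fixes \<phi> :: "'k::{finite,linorder} \<Rightarrow> real^3 \<Rightarrow> real"
    and V w :: "real^3 \<Rightarrow> real"
    and e :: "nat \<Rightarrow> 'k set"
    and t :: "real^('k set)"
  assumes "CARD('n::{finite,linorder}) \<le> CARD('k)"
    and "\<And>p. \<phi> p \<in> sobolev 2"
    and "\<And>p q. L2_inner (\<phi> p) (\<phi> q) = (if p = q then 1 else 0)"
    and "V \<in> L32_plus_Linf_eps"
    and "w \<in> L32_plus_Linf_eps"
    and "AE x in lborel. w (- x) = w x"
    and "bij_betw e {..<card (excited CARD('n) :: 'k set set)} (excited CARD('n))"
    and "cc_zero TYPE('n) \<phi> V w t"
  shows
    "let N = CARD('n);
         \<Psi> = wavefunction \<phi> (exp_op (cluster N t) (reference N)) :: 'n config \<Rightarrow> real;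
         \<E> = eigenvalue_list TYPE('n) \<phi> V w;
         simple_eigenfunction = (\<lambda>\<nu>. \<nu> < length \<E> \<and> eigenfunction \<phi> V w \<Psi> (\<E> ! \<nu>) \<and>
                                     simple_eigenvalue TYPE('n) \<phi> V w (\<E> ! \<nu>))
     in \<Psi> \<in> antisymmetric_sobolev 2 \<and>
        L2_inner \<Psi> (wavefunction \<phi> (reference N)) = 1 \<and>
        ((\<exists>\<nu>. simple_eigenfunction \<nu>) \<longleftrightarrow> nondegenerate TYPE('n) \<phi> V w t) \<and>
        (\<forall>\<nu>. simple_eigenfunction \<nu> \<longrightarrow>
             isolated_cc_zero TYPE('n) \<phi> V w t \<and> cc_index TYPE('n) \<phi> V w e t = (-1) ^ \<nu>)"
proof -
  let ?N = "CARD('n)"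
  let ?H = "HK TYPE('n) \<phi> V w"
  let ?m = "card (excited ?N :: 'k set set)"
  note N = assms(1) and on = assms(3) and e = assms(7)
  have L2: "\<phi> p \<in> L2" for p using assms(2) by (rule sobolev_imp_L2)
  note zero_iff = cc_zero_iff[OF N L2 on, where V = V and w = w]
    and vec_eq = cc_vec_eq[OF N L2 on, where V = V and w = w]
  interpret cc_operator ?N ?H by (rule cc_operator_HK[OF N])
  interpret cc_solution ?N ?H t
    using assms(8) unfolding zero_iff by unfold_locales auto
  obtain b where "eigenbasis ?H (sector ?N \<inter> {x. \<psi> \<bullet> x = 0}) (b ` {..<?m})" "inj_on b {..<?m}"
    by (rule exists_eigenbasis)
  then interpret cc_eigenbasis ?N ?H t b ?m
    by unfold_locales auto
  define \<Psi> :: "'n config \<Rightarrow> real" where "\<Psi> = wavefunction \<phi> \<psi>"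
  define \<E> where "\<E> = eigenvalue_list TYPE('n) \<phi> V w"
  define simple_eigenfunction where "simple_eigenfunction \<nu> \<longleftrightarrow> \<nu> < length \<E> \<and> eigenfunction \<phi> V w \<Psi> (\<E> ! \<nu>) \<and>
      simple_eigenvalue TYPE('n) \<phi> V w (\<E> ! \<nu>)" for \<nu>
  have \<Psi>: "wavefunction \<phi> (exp_op (cluster ?N t) (reference ?N)) = \<Psi>"
    by (simp add: \<Psi>_def \<psi>_def exp_op_cluster[OF N])
  have dim_eq: "dim (eigenspace TYPE('n) \<phi> V w E) = count spectrum E" for E
    unfolding eigenspace_def by (rule dim_eigenspace_count)
  have \<E>: "\<E> = sorted_list_of_multiset spectrum"
    unfolding \<E>_def eigenvalue_list_def by (rule the_sorted_list_count) (simp add: dim_eq)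
  then have mset_\<E>: "mset \<E> = spectrum" and sorted_\<E>: "sorted \<E>"
    by (simp_all add: sorted_sorted_list_of_multiset)
  have eigen: "eigenfunction \<phi> V w \<Psi> E \<longleftrightarrow> E = energy" for E
  proof
    assume "eigenfunction \<phi> V w \<Psi> E"
    then obtain c where c: "c \<in> sector ?N" "?H c = E *\<^sub>R c" "wavefunction \<phi> \<psi> = (wavefunction \<phi> c :: 'n config \<Rightarrow> real)"
      by (auto simp: eigenfunction_def eigenspace_def \<Psi>_def)
    have "\<psi> = c" by (rule wavefunction_eqD[OF L2 on c(3) \<psi>_sector c(1)])
    then show "E = energy" using H_\<psi> c(2) \<psi>_nonzero by simp
  next
    assume "E = energy"
    then show "eigenfunction \<phi> V w \<Psi> E"
      using \<psi>_sector H_\<psi> \<psi>_nonzero by (auto simp: eigenfunction_def eigenspace_def \<Psi>_def)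
  qed
  have simple_iff: "simple_eigenfunction \<nu> \<longleftrightarrow> \<nu> < length \<E> \<and> \<E> ! \<nu> = energy \<and> (\<forall>i<?m. lam i \<noteq> energy)" for \<nu>
    unfolding simple_eigenfunction_def eigen simple_eigenvalue_def dim_eq
    using count_spectrum_energy by auto
  have nondeg_iff: "nondegenerate TYPE('n) \<phi> V w t \<longleftrightarrow> (\<forall>i<?m. lam i \<noteq> energy)"
    unfolding nondegenerate_def vec_eq nondegenerate_iff L_injective_iff ..
  have "\<Psi> \<in> antisymmetric_sobolev 2"
    unfolding \<Psi>_def using assms(2) by (rule wavefunction_sobolev)
  moreover have "L2_inner \<Psi> (wavefunction \<phi> (reference ?N)) = 1"
  proof -
    have "L2_inner \<Psi> (wavefunction \<phi> (reference ?N))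
       = (\<Sum>\<alpha> | card \<alpha> = ?N. if \<alpha> = occupied ?N then \<psi> $ \<alpha> else 0)"
      unfolding \<Psi>_def L2_inner_wavefunction[OF L2 on] by (intro sum.cong) (auto simp: reference_nth)
    then show ?thesis by (simp add: card_occupied[OF N] \<psi>_occupied)
  qed
  moreover have "(\<exists>\<nu>. simple_eigenfunction \<nu>) \<longleftrightarrow> nondegenerate TYPE('n) \<phi> V w t"
  proof -
    have "energy \<in> set \<E>" by (simp add: spectrum_def flip: set_mset_mset add: mset_\<E>)
    then have "\<exists>\<nu><length \<E>. \<E> ! \<nu> = energy" by (simp add: in_set_conv_nth)
    then show ?thesis unfolding simple_iff nondeg_iff by blast
  qed
  moreover have "isolated_cc_zero TYPE('n) \<phi> V w t \<and> cc_index TYPE('n) \<phi> V w e t = (-1) ^ \<nu>"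
    if "simple_eigenfunction \<nu>" for \<nu>
  proof
    from that have \<nu>: "\<nu> < length \<E>" "\<E> ! \<nu> = energy" and ne: "\<forall>i<?m. lam i \<noteq> energy"
      by (auto simp: simple_iff)
    show "isolated_cc_zero TYPE('n) \<phi> V w t"
      using cc_isolated[OF ne] t_amplitudes cc_t unfolding isolated_cc_zero_def zero_iff by blast
    have "count_list \<E> (\<E> ! \<nu>) = 1"
      using count_spectrum_energy ne by (simp add: \<nu>(2) mset_\<E> flip: count_mset)
    from sorted_nth_simple[OF sorted_\<E> \<nu>(1) this]
    have "card {i. i < ?m \<and> lam i < energy} = \<nu>"
      by (simp add: \<nu>(2) mset_\<E> size_spectrum_below)
    then show "cc_index TYPE('n) \<phi> V w e t = (-1) ^ \<nu>"
      using zero_index_cc[OF ne e] by (simp add: cc_index_def vec_eq)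
  qed
  ultimately show ?thesis
    unfolding Let_def \<Psi> \<E>_def[symmetric] simple_eigenfunction_def[symmetric] by blast
qed

end
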